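(* Let $\Omega\subset\mathbb{R}^d$ be open, bounded and convex, let $n\ge1$, and let $\{g_\varepsilon\}_{\varepsilon>0}$ be an admissible smoothing family. For $i=1,\ldots,n$ let $\{\phi_{i,m}\}_{m=1}^\infty\subset C^2(\overline{\Omega})$ be sequences converging to $\phi_i$ in $C(\overline{\Omega})$. Set $$L_m=\sup_{i\in\{1,\ldots,n\}}\|\nabla\phi_{i,m}\|_{C(\overline{\Omega};\mathbb{R}^d)},\qquad C_m=\sup_{i\in\{1,\ldots,n\}}\|\nabla^2\phi_{i,m}\|_{C(\overline{\Omega};\mathbb{R}^{d\times d})},$$ and assume that there exist $L>0$ and $C>0$ with $\limsup_{m\to\infty}L_m\le L$ and $\limsup_{m\to\infty}C_m\le C$. For $m\in\mathbb{N}$ and $\varepsilon\ge0$ set $$v_n=\min_{i=1,\ldots,n}\phi_i,\qquad v_{n,m,\varepsilon}=\psi_{n,\varepsilon}\circ\Phi_{n,m},\qquad \Phi_{n,m}(x)=(\phi_{1,m}(x),\ldots,\phi_{n,m}(x))\ \text{ for }x\in\overline\Omega,$$ and $$E_{m,\varepsilon}=\sup_{i=1,\ldots,n}\|\phi_i-\phi_{i,m}\|_{C(\overline{\Omega})}+(n-1)\varepsilon.$$ Then, for all $m\in\mathbb{N}$ and $\varepsilon\ge0$, $$\|v_n-v_{n,m,\varepsilon}\|_{C(\overline{\Omega})}\le E_{m,\varepsilon},$$ and, if $p\ge2$ (with $p<\infty$), $$\|\nabla v_{n,m,\varepsilon}-\nabla v_n\|_{L^p(\Omega;\mathbb{R}^d)}\le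 L^{\frac{p-2}{p}}\Big(K\,E_{m,\varepsilon}\,(C+L+E_{m,\varepsilon})\Big)^{\frac1p},$$ while if $p\in[1,2)$, $$\|\nabla v_{n,m,\varepsilon}-\nabla v_n\|_{L^p(\Omega;\mathbb{R}^d)}\le|\Omega|^{\frac{2-p}{2p}}\Big(K\,E_{m,\varepsilon}\,(C+L+E_{m,\varepsilon})\Big)^{\frac12},$$ where $K$ is a constant depending only on $\Omega$. Further, $v_n$ is $C$-semiconcave and $L$-Lipschitz.
   Context: A function $v\in C(\overline{\Omega})$ is $C$-semiconcave if $x\mapsto v(x)-\frac{C}{2}|x|^2$ is concave on $\Omega$. $|\Omega|$ is Lebesgue measure; matrices carry the operator norm. $(x)_+=\max\{x,0\}$. A family $\{g_\varepsilon\}_{\varepsilon>0}\subset C^{1,1}(\mathbb{R})$ ($C^1$ functions with Lipschitz derivative) is called an admissible smoothing family if for every $\varepsilon>0$: $g_\varepsilon(x)\ge 0$ and $g_\varepsilon'(x)\in[0,1]$ for all $x\in\mathbb{R}$; $g_\varepsilon''(x)\ge 0$ for almost all $x\in\mathbb{R}$; $\sup_{x\in\mathbb{R}}|(x)_+-g_\varepsilon(x)|\le\varepsilon$; $g_\varepsilon''\in L^\infty(\mathbb{R})$; and, moreover, $g_\varepsilon'\to\chi_{[0,\infty)}$ uniformly on compact subsets of $\mathbb{R}\setminus\{0\}$ as $\varepsilon\to0^+$. The smoothed minimum of $a\in\mathbb{R}^n$ is defined, for $\varepsilon>0$, recursively by $\psi_{1,\varepsilon}(a)=a_1$ and $\psi_{i+1,\varepsilon}(a)=a_{i+1}-g_\varepsilon(a_{i+1}-\psi_{i,\varepsilon}(a))$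 for $i\in\{1,\ldots,n-1\}$; for $\varepsilon=0$, $\psi_{n,0}(a)=\psi_n(a)=\min_{1\le i\le n}a_i$.
   Formalization: The gradient estimates are proved for all sufficiently large m, and for every m with L_m ≤ L and C_m ≤ C (for arbitrary m they fail), and for p > 2 the constant K may depend on p as well as Ω (no single K works for all p); on [1,2] K depends only on Ω. *)

theory Defs
  imports "HOL-Analysis.Analysis"
begin

text \<open>
  \<open>\<real>\<^sup>d\<close> is an arbitrary type of class \<open>euclidean_space\<close>. Finite families indexed by \<open>1,\<dots>,n\<close> and
  vectors in \<open>\<real>\<^sup>n\<close> are functions on \<open>nat\<close> of which only the values on \<open>{1..n}\<close> are used.
\<close>

section \<open>Norms\<close>

text \<open>
  The inserted \<open>0\<close> only matters for \<open>S = {}\<close>, where the supremum of the empty set of reals is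
  unspecified. The supremum is meaningful for functions that are bounded on \<open>S\<close>.
\<close>
definition sup_norm :: "'a set \<Rightarrow> ('a \<Rightarrow> 'b::real_normed_vector) \<Rightarrow> real" where
  "sup_norm S f = Sup (insert 0 ((\<lambda>x. norm (f x)) ` S))"

definition in_Lp :: "real \<Rightarrow> 'a::euclidean_space set \<Rightarrow> ('a \<Rightarrow> 'b::euclidean_space) \<Rightarrow> bool" where
  "in_Lp p \<Omega> F \<longleftrightarrow> F \<in> borel_measurable (lebesgue_on \<Omega>) \<and>
     integrable (lebesgue_on \<Omega>) (\<lambda>x. norm (F x) powr p)"

text \<open>To be used together with \<^const>\<open>in_Lp\<close>, as the integral is \<open>0\<close> for non-integrable functions.\<close>
definition Lp_norm :: "real \<Rightarrow> 'a::euclidean_space set \<Rightarrow> ('a \<Rightarrow> 'b::euclidean_space) \<Rightarrow> real" where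
  "Lp_norm p \<Omega> F = (\<integral>x. norm (F x) powr p \<partial>lebesgue_on \<Omega>) powr (1 / p)"


section \<open>Gradient, Hessian and \<open>C\<^sup>2\<close> up to the boundary\<close>

text \<open>
  Classical gradient; its value at points of non-differentiability is unspecified. For Lipschitz
  functions on an open set it agrees almost everywhere with the weak gradient.
\<close>
definition grad :: "('a::euclidean_space \<Rightarrow> real) \<Rightarrow> 'a \<Rightarrow> 'a" where
  "grad f x = (THE D. GDERIV f x :> D)"

text \<open>The norm of the type \<open>'a \<Rightarrow>\<^sub>L 'a\<close> is the operator norm.\<close>
definition hess :: "('a::euclidean_space \<Rightarrow> real) \<Rightarrow> 'a \<Rightarrow> 'a \<Rightarrow>\<^sub>L 'a" where
  "hess f x = (THE A. (grad f has_derivative blinfun_apply A) (at x))"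

text \<open>
  The function is continuous on the closure and twice differentiable in the open set, and its first
  and second derivatives have continuous extensions \<open>G\<close>, \<open>H\<close> to the closure. By density the norms of
  \<open>G\<close> and \<open>H\<close> over the closure equal the suprema over the open set of the norms of
  \<^term>\<open>grad f\<close> and \<^term>\<open>hess f\<close>.
\<close>
definition C2_closure :: "'a::euclidean_space set \<Rightarrow> ('a \<Rightarrow> real) \<Rightarrow> bool" where
  "C2_closure \<Omega> f \<longleftrightarrow> continuous_on (closure \<Omega>) f \<and>
     (\<exists>G H. continuous_on (closure \<Omega>) G \<and> continuous_on (closure \<Omega>) H \<and>
       (\<forall>x\<in>\<Omega>. GDERIV f x :> grad f x \<and> G x = grad f x \<and>
              (grad f has_derivative blinfun_apply (hess f x)) (at x) \<and> H x = hess f x))"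

definition semiconcave :: "real \<Rightarrow> 'a::euclidean_space set \<Rightarrow> ('a \<Rightarrow> real) \<Rightarrow> bool" where
  "semiconcave C \<Omega> v \<longleftrightarrow> continuous_on (closure \<Omega>) v \<and>
     concave_on \<Omega> (\<lambda>x. v x - C / 2 * (norm x)\<^sup>2)"


section \<open>Smoothed minimum\<close>

definition C11 :: "(real \<Rightarrow> real) \<Rightarrow> bool" where
  "C11 f \<longleftrightarrow> (\<forall>x. f differentiable at x) \<and> (\<exists>B. B-lipschitz_on UNIV (deriv f))"

definition admissible_smoothing :: "(real \<Rightarrow> real \<Rightarrow> real) \<Rightarrow> bool" where
  "admissible_smoothing g \<longleftrightarrow>
     (\<forall>\<epsilon>>0. C11 (g \<epsilon>) \<and>
        (\<forall>x. 0 \<le> g \<epsilon> x \<and> deriv (g \<epsilon>) x \<in> {0..1}) \<and>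
        (AE x in lebesgue. deriv (g \<epsilon>) differentiable at x \<and> 0 \<le> deriv (deriv (g \<epsilon>)) x) \<and>
        (\<forall>x. \<bar>max x 0 - g \<epsilon> x\<bar> \<le> \<epsilon>) \<and>
        (\<exists>B. AE x in lebesgue. \<bar>deriv (deriv (g \<epsilon>)) x\<bar> \<le> B)) \<and>
     (\<forall>S. compact S \<and> S \<subseteq> UNIV - {0} \<longrightarrow>
        uniform_limit S (\<lambda>\<epsilon>. deriv (g \<epsilon>)) (indicat_real {0..}) (at_right 0))"

text \<open>The value at index \<open>0\<close> is a dummy.\<close>
fun smooth_min_rec :: "(real \<Rightarrow> real) \<Rightarrow> nat \<Rightarrow> (nat \<Rightarrow> real) \<Rightarrow> real" where
  "smooth_min_rec h 0 a = 0"
| "smooth_min_rec h (Suc 0) a = a 1"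
| "smooth_min_rec h (Suc (Suc i)) a =
     a (Suc (Suc i)) - h (a (Suc (Suc i)) - smooth_min_rec h (Suc i) a)"

definition smooth_min :: "(real \<Rightarrow> real \<Rightarrow> real) \<Rightarrow> nat \<Rightarrow> real \<Rightarrow> (nat \<Rightarrow> real) \<Rightarrow> real" where
  "smooth_min g n \<epsilon> a =
     (if \<epsilon> = 0 then (MIN i\<in>{1..n}. a i) else smooth_min_rec (g \<epsilon>) n a)"


section \<open>The approximations and their data\<close>

text \<open>In the following \<open>\<phi>' i m\<close> stands for \<open>\<phi>\<^bsub>i,m\<^esub>\<close>.\<close>

definition v_min :: "nat \<Rightarrow> (nat \<Rightarrow> 'a \<Rightarrow> real) \<Rightarrow> 'a \<Rightarrow> real" where
  "v_min n \<phi> x = (MIN i\<in>{1..n}. \<phi> i x)"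

definition v_approx ::
  "(real \<Rightarrow> real \<Rightarrow> real) \<Rightarrow> nat \<Rightarrow> (nat \<Rightarrow> nat \<Rightarrow> 'a \<Rightarrow> real) \<Rightarrow> nat \<Rightarrow> real \<Rightarrow> 'a \<Rightarrow> real" where
  "v_approx g n \<phi>' m \<epsilon> x = smooth_min g n \<epsilon> (\<lambda>i. \<phi>' i m x)"

definition grad_bound ::
  "'a::euclidean_space set \<Rightarrow> nat \<Rightarrow> (nat \<Rightarrow> nat \<Rightarrow> 'a \<Rightarrow> real) \<Rightarrow> nat \<Rightarrow> real" where
  "grad_bound \<Omega> n \<phi>' m = (MAX i\<in>{1..n}. sup_norm \<Omega> (grad (\<phi>' i m)))"

definition hess_bound ::
  "'a::euclidean_space set \<Rightarrow> nat \<Rightarrow> (nat \<Rightarrow> nat \<Rightarrow> 'a \<Rightarrow> real) \<Rightarrow> nat \<Rightarrow> real" where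
  "hess_bound \<Omega> n \<phi>' m = (MAX i\<in>{1..n}. sup_norm \<Omega> (hess (\<phi>' i m)))"

definition err ::
  "'a::euclidean_space set \<Rightarrow> nat \<Rightarrow> (nat \<Rightarrow> 'a \<Rightarrow> real) \<Rightarrow> (nat \<Rightarrow> nat \<Rightarrow> 'a \<Rightarrow> real)
     \<Rightarrow> nat \<Rightarrow> real \<Rightarrow> real" where
  "err \<Omega> n \<phi> \<phi>' m \<epsilon> =
     (MAX i\<in>{1..n}. sup_norm (closure \<Omega>) (\<lambda>x. \<phi> i x - \<phi>' i m x)) + (real n - 1) * \<epsilon>"

end

theory Submission
  imports Defs
begin

text \<open>
  The gradient estimate holds for any two \<open>C\<close>-semiconcave, \<open>L\<close>-Lipschitz functions \<open>v\<close>, \<open>w\<close> with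
  \<open>\<bar>v - w\<bar> \<le> E\<close>. Along an arithmetic progression with step \<open>h = 1/N\<close> in a coordinate direction, the
  second differences of \<open>v\<close> and \<open>w\<close> are bounded above by \<open>C h\<^sup>2\<close> and telescope, so the sum of their
  absolute values is at most of order \<open>(L + C) h\<close>. Summation by parts then bounds the sum of the squared
  first differences of \<open>v - w\<close> by a multiple of \<open>E (L + C) h\<close>. By translation invariance, integrating
  over the starting point bounds the \<open>L\<^sup>2\<close> norm of the difference quotients, and Fatou's lemma gives
  \<open>\<integral> \<bar>\<nabla>v - \<nabla>w\<bar>\<^sup>2 \<le> K E (L + C)\<close>. The same averaging shows that
  the symmetric second difference quotients of a concave Lipschitz function tend to zero almost
  everywhere along a subsequence, which forces differentiability there.
  The other exponents follow from the \<open>L\<^sup>\<infinity>\<close> bound on the gradients and from Hoelder's inequality.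
\<close>

section \<open>Summation by parts along arithmetic progressions\<close>

text \<open>The second derivatives of semiconcave functions are only measures, so the integration by
  parts behind the estimate is carried out on finite differences, and gradients appear only in the
  limit of small steps. The boundary of \<Omega> is harmless: by convexity the points of a
  progression that lie in \<Omega> have consecutive indices, so each progression produces just two
  boundary terms, both of order \<open>E * L * h\<close>.

  The hypotheses on \<open>grad_bound\<close> and \<open>hess_bound\<close> are asymptotic. A small,
  rapidly oscillating perturbation has a small \<open>err\<close> but a large gradient, so no
  estimate of this form can hold for an \<open>m\<close> whose derivatives are not controlled; hence
  the threshold \<open>M\<close>, with the alternative that the bounds hold at \<open>m\<close>
  itself. Beyond the threshold the bounds are \<open>2 * L\<close> and \<open>2 * C\<close>, so the
  gradients differ by at most \<open>4 * L\<close>; this is the origin of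
  \<open>4 powr (p - 2)\<close> in \<open>K\<close>. A dependence of \<open>K\<close> on
  \<open>p\<close> cannot be avoided: for fixed \<open>K\<close> and positive \<open>E\<close> the
  right-hand side tends to \<open>L\<close> as \<open>p\<close> tends to infinity, while the
  gradients of two L-Lipschitz functions can differ by \<open>2 * L\<close> on a set of positive
  measure.\<close>

lemma sum_abs_second_diff_le:
  fixes a :: "nat \<Rightarrow> real"
  assumes M: "0 \<le> M" and c: "0 \<le> c"
    and lip: "\<And>k. Suc k \<le> n \<Longrightarrow> \<bar>a (Suc k) - a k\<bar> \<le> M"
    and conc: "\<And>k. Suc (Suc k) \<le> n \<Longrightarrow> a (Suc (Suc k)) - 2 * a (Suc k) + a k \<le> c"
  shows "(\<Sum>k\<in>{k. Suc (Suc k) \<le> n}. \<bar>a (Suc (Suc k)) - 2 * a (Suc k) + a k\<bar>) \<le> 2 * M + 2 * c * real n"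
proof (cases "n")
  case 0
  then show ?thesis using M by simp
next
  case (Suc m)
  have eq: "{k. Suc (Suc k) \<le> n} = {..<m}" using Suc by auto
  \<comment> \<open>For a number \<open>d\<close> with \<open>d \<le> c\<close> and
    \<open>0 \<le> c\<close> one has |d| \<le> 2c - d, and the sum of the terms -d telescopes to a
    difference of two first differences.\<close>
  have "(\<Sum>k<m. \<bar>a (Suc (Suc k)) - 2 * a (Suc k) + a k\<bar>)
      \<le> (\<Sum>k<m. 2 * c - (a (Suc (Suc k)) - 2 * a (Suc k) + a k))"
    using conc Suc c by (intro sum_mono) (smt (verit) lessThan_iff Suc_leI Suc_mono)
  also have "\<dots> = 2 * c * real m - ((a (Suc m) - a m) - (a (Suc 0) - a 0))"
    by (induction m) (auto simp: algebra_simps)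
  also have "\<dots> \<le> 2 * M + 2 * c * real n"
  proof -
    have "\<bar>a (Suc m) - a m\<bar> \<le> M" "\<bar>a (Suc 0) - a 0\<bar> \<le> M" using lip Suc by auto
    moreover have "2 * c * real m \<le> 2 * c * real n" using c Suc by (intro mult_left_mono) auto
    ultimately show ?thesis by linarith
  qed
  finally show ?thesis unfolding eq .
qed

text \<open>Discrete counterpart of u'^2 = (u u')' - u u'': the \<open>m + 1\<close> squared first
  differences leave two end terms and \<open>m\<close> second differences, each weighted by the
  value at its centre.\<close>

lemma summation_by_parts_squares:
  fixes u :: "nat \<Rightarrow> real"
  shows "(\<Sum>k<Suc m. (u (Suc k) - u k)\<^sup>2) = u (Suc m) * (u (Suc m) - u m) - u 0 * (u (Suc 0) - u 0)
    - (\<Sum>k<m. u (Suc k) * (u (Suc (Suc k)) - 2 * u (Suc k) + u k))"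
  by (induction m) (simp_all add: algebra_simps power2_eq_square)

text \<open>The second differences of \<open>v - w\<close> have no one-sided bound, but their
  absolute values are at most those of \<open>v\<close> plus those of \<open>w\<close>, and each of
  these sums is controlled separately. The end terms contribute \<open>4 * E * M\<close>, the
  interior \<open>E * (4 * M + 4 * c * n)\<close>.\<close>

lemma sum_squares_diff_le:
  fixes v w :: "nat \<Rightarrow> real"
  assumes M: "0 \<le> M" and c: "0 \<le> c" and E: "\<And>k. k \<le> n \<Longrightarrow> \<bar>v k - w k\<bar> \<le> E"
    and v: "\<And>k. Suc k \<le> n \<Longrightarrow> \<bar>v (Suc k) - v k\<bar> \<le> M"
      "\<And>k. Suc (Suc k) \<le> n \<Longrightarrow> v (Suc (Suc k)) - 2 * v (Suc k) + v k \<le> c"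
    and w: "\<And>k. Suc k \<le> n \<Longrightarrow> \<bar>w (Suc k) - w k\<bar> \<le> M"
      "\<And>k. Suc (Suc k) \<le> n \<Longrightarrow> w (Suc (Suc k)) - 2 * w (Suc k) + w k \<le> c"
  shows "(\<Sum>k<n. ((v (Suc k) - w (Suc k)) - (v k - w k))\<^sup>2) \<le> E * (8 * M + 4 * c * real n)"
proof (cases "n")
  case 0
  have "0 \<le> E" using E[of 0] by simp
  then show ?thesis using M 0 by simp
next
  case (Suc m)
  define u where "u k = v k - w k" for k
  have uE: "\<bar>u k\<bar> \<le> E" if "k \<le> n" for k using E that unfolding u_def by auto
  have E0: "0 \<le> E" using E[of 0] by simp
  have du: "\<bar>u (Suc k) - u k\<bar> \<le> 2 * M" if "Suc k \<le> n" for k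
    using v(1)[OF that] w(1)[OF that] unfolding u_def by linarith
  have prod: "\<bar>u j * (u (Suc k) - u k)\<bar> \<le> E * (2 * M)" if "j \<le> n" "Suc k \<le> n" for j k
    unfolding abs_mult using uE du that E0 by (intro mult_mono) auto
  have eq: "{k. Suc (Suc k) \<le> n} = {..<m}" using Suc by auto
  let ?d = "\<lambda>a k. a (Suc (Suc k)) - 2 * a (Suc k) + (a k :: real)"
  have "- (\<Sum>k<m. u (Suc k) * ?d u k) \<le> (\<Sum>k<m. \<bar>u (Suc k) * ?d u k\<bar>)"
    by (rule order_trans[OF abs_ge_minus_self sum_abs])
  also have "\<dots> \<le> (\<Sum>k<m. E * (\<bar>?d v k\<bar> + \<bar>?d w k\<bar>))"
  proof (intro sum_mono)
    fix k assume "k \<in> {..<m}"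
    then have "\<bar>u (Suc k)\<bar> \<le> E" using uE Suc by simp
    moreover have "\<bar>?d u k\<bar> \<le> \<bar>?d v k\<bar> + \<bar>?d w k\<bar>"
    proof -
      have "?d u k = ?d v k - ?d w k" unfolding u_def by (simp add: algebra_simps)
      then show ?thesis by (metis abs_triangle_ineq4)
    qed
    ultimately show "\<bar>u (Suc k) * ?d u k\<bar> \<le> E * (\<bar>?d v k\<bar> + \<bar>?d w k\<bar>)"
      unfolding abs_mult using E0 by (intro mult_mono) auto
  qed
  also have "\<dots> = E * ((\<Sum>k<m. \<bar>?d v k\<bar>) + (\<Sum>k<m. \<bar>?d w k\<bar>))"
    by (simp add: sum_distrib_left sum.distrib algebra_simps)
  also have "\<dots> \<le> E * ((2 * M + 2 * c * real n) + (2 * M + 2 * c * real n))"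
    using sum_abs_second_diff_le[of M c n v, OF M c, unfolded eq, OF v]
      sum_abs_second_diff_le[of M c n w, OF M c, unfolded eq, OF w] E0
    by (intro mult_left_mono add_mono) auto
  finally have interior: "- (\<Sum>k<m. u (Suc k) * ?d u k) \<le> E * (4 * M + 4 * c * real n)"
    by (simp add: algebra_simps)
  have "(\<Sum>k<n. (u (Suc k) - u k)\<^sup>2) \<le> E * (8 * M + 4 * c * real n)"
  proof -
    have "u (Suc m) * (u (Suc m) - u m) \<le> E * (2 * M)" using prod[of "Suc m" m] Suc by simp
    moreover have "- (u 0 * (u (Suc 0) - u 0)) \<le> E * (2 * M)" using prod[of 0 0] Suc by simp
    moreover have "E * (2 * M) + E * (2 * M) + E * (4 * M + 4 * c * real n) = E * (8 * M + 4 * c * real n)"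
      by (simp add: algebra_simps)
    ultimately show ?thesis
      unfolding Suc summation_by_parts_squares using interior[unfolded Suc] by linarith
  qed
  then show ?thesis unfolding u_def .
qed

text \<open>For membership of the points of a progression in a convex set. Recording the block by
  its start \<open>p\<close> and length \<open>n\<close> lets a sum over it be shifted to one that
  starts at index 0.\<close>

lemma interval_pred_nat_cases:
  fixes P :: "nat \<Rightarrow> bool"
  assumes P: "\<And>i j k. i \<le> j \<Longrightarrow> j \<le> k \<Longrightarrow> P i \<Longrightarrow> P k \<Longrightarrow> P j"
  shows "(\<forall>k\<le>N. \<not> P k) \<or> (\<exists>p n. p + n \<le> N \<and> (\<forall>k\<le>N. P k \<longleftrightarrow> p \<le> k \<and> k \<le> p + n))"
proof -
  define J where "J = {k. k \<le> N \<and> P k}"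
  have fin: "finite J" unfolding J_def by auto
  show ?thesis
  proof (cases "J = {}")
    case True
    then show ?thesis unfolding J_def by auto
  next
    case False
    have mem: "Min J \<in> J" "Max J \<in> J" using fin False by auto
    have le: "Min J \<le> Max J" using fin mem by auto
    show ?thesis
    proof (intro disjI2 exI conjI allI impI)
      show "Min J + (Max J - Min J) \<le> N" using le mem unfolding J_def by auto
      fix k assume k: "k \<le> N"
      show "P k \<longleftrightarrow> Min J \<le> k \<and> k \<le> Min J + (Max J - Min J)"
      proof
        assume "P k"
        then have "k \<in> J" using k J_def by auto
        then show "Min J \<le> k \<and> k \<le> Min J + (Max J - Min J)" using le fin by simp
      next
        assume "Min J \<le> k \<and> k \<le> Min J + (Max J - Min J)"
        then show "P k" using P[of "Min J" k "Max J"] mem le unfolding J_def by auto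
      qed
    qed
  qed
qed

text \<open>Terms that would leave the admissible indices are set to zero instead of being dropped
  from the index set, so the number of terms is the same for every starting point. This is what
  later allows integration over the starting point.\<close>

lemma sum_abs_second_diff_le_interval:
  fixes a :: "nat \<Rightarrow> real" and P :: "nat \<Rightarrow> bool"
  assumes P: "\<And>i j k. i \<le> j \<Longrightarrow> j \<le> k \<Longrightarrow> P i \<Longrightarrow> P k \<Longrightarrow> P j"
    and M: "0 \<le> M" and c: "0 \<le> c"
    and lip: "\<And>k. P k \<Longrightarrow> P (Suc k) \<Longrightarrow> \<bar>a (Suc k) - a k\<bar> \<le> M"
    and conc: "\<And>k. P k \<Longrightarrow> P (Suc (Suc k)) \<Longrightarrow> a (Suc (Suc k)) - 2 * a (Suc k) + a k \<le> c"
  shows "(\<Sum>k<N. if P k \<and> P (Suc (Suc k)) then \<bar>a (Suc (Suc k)) - 2 * a (Suc k) + a k\<bar> else 0)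
    \<le> 2 * M + 2 * c * real (Suc N)"
proof -
  \<comment> \<open>A second difference at \<open>k < N\<close> reaches up to index
    \<open>Suc (Suc k)\<close>, so the block has to be determined up to
    \<open>Suc N\<close>.\<close>
  have "(\<forall>k\<le>Suc N. \<not> P k) \<or> (\<exists>p n. p + n \<le> Suc N \<and> (\<forall>k\<le>Suc N. P k \<longleftrightarrow> p \<le> k \<and> k \<le> p + n))"
    by (rule interval_pred_nat_cases) (fact P)
  then consider (empty) "\<And>k. k \<le> Suc N \<Longrightarrow> \<not> P k"
    | (run) p n where "p + n \<le> Suc N" "\<And>k. k \<le> Suc N \<Longrightarrow> P k \<longleftrightarrow> p \<le> k \<and> k \<le> p + n"
    by metis
  then show ?thesis
  proof cases
    case empty
    then show ?thesis using M c by (simp add: sum.neutral)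
  next
    case (run p n)
    let ?d = "\<lambda>k. \<bar>a (Suc (Suc k)) - 2 * a (Suc k) + a k\<bar>"
    have in_run: "P (p + k)" if "k \<le> n" for k using run that by simp
    have "(\<Sum>k<N. if P k \<and> P (Suc (Suc k)) then ?d k else 0)
        = (\<Sum>k\<in>{k. k < N \<and> P k \<and> P (Suc (Suc k))}. ?d k)"
      by (subst sum.inter_filter[symmetric]) auto
    also have "{k. k < N \<and> P k \<and> P (Suc (Suc k))} = (+) p ` {k. Suc (Suc k) \<le> n}"
    proof (intro equalityI subsetI)
      fix k assume "k \<in> {k. k < N \<and> P k \<and> P (Suc (Suc k))}"
      then have "p \<le> k" "Suc (Suc k) \<le> p + n" using run(2)[of k] run(2)[of "Suc (Suc k)"] by auto
      then show "k \<in> (+) p ` {k. Suc (Suc k) \<le> n}" by (intro image_eqI[of _ _ "k - p"]) auto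
    next
      fix k assume "k \<in> (+) p ` {k. Suc (Suc k) \<le> n}"
      then obtain j where "k = p + j" "Suc (Suc j) \<le> n" by auto
      then show "k \<in> {k. k < N \<and> P k \<and> P (Suc (Suc k))}"
        using run(1) in_run[of j] in_run[of "Suc (Suc j)"] by auto
    qed
    also have "(\<Sum>k\<in>\<dots>. ?d k) = (\<Sum>k\<in>{k. Suc (Suc k) \<le> n}. ?d (p + k))"
      by (subst sum.reindex) (auto simp: inj_on_def)
    also have "\<dots> \<le> 2 * M + 2 * c * real n"
    proof -
      have "\<bar>a (p + Suc k) - a (p + k)\<bar> \<le> M" if "Suc k \<le> n" for k
        using lip[of "p + k"] in_run[of k] in_run[of "Suc k"] that by simp
      moreover have "a (p + Suc (Suc k)) - 2 * a (p + Suc k) + a (p + k) \<le> c" if "Suc (Suc k) \<le> n" for k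
        using conc[of "p + k"] in_run[of k] in_run[of "Suc (Suc k)"] that by simp
      ultimately show ?thesis using sum_abs_second_diff_le[OF M c, of n "\<lambda>k. a (p + k)"] by simp
    qed
    also have "\<dots> \<le> 2 * M + 2 * c * real (Suc N)"
      using run(1) c by (intro add_left_mono mult_left_mono) auto
    finally show ?thesis .
  qed
qed

lemma sum_squares_diff_le_interval:
  fixes v w :: "nat \<Rightarrow> real" and P :: "nat \<Rightarrow> bool"
  assumes P: "\<And>i j k. i \<le> j \<Longrightarrow> j \<le> k \<Longrightarrow> P i \<Longrightarrow> P k \<Longrightarrow> P j"
    and M: "0 \<le> M" and c: "0 \<le> c" and E0: "0 \<le> E" and E: "\<And>k. P k \<Longrightarrow> \<bar>v k - w k\<bar> \<le> E"
    and v: "\<And>k. P k \<Longrightarrow> P (Suc k) \<Longrightarrow> \<bar>v (Suc k) - v k\<bar> \<le> M"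
      "\<And>k. P k \<Longrightarrow> P (Suc (Suc k)) \<Longrightarrow> v (Suc (Suc k)) - 2 * v (Suc k) + v k \<le> c"
    and w: "\<And>k. P k \<Longrightarrow> P (Suc k) \<Longrightarrow> \<bar>w (Suc k) - w k\<bar> \<le> M"
      "\<And>k. P k \<Longrightarrow> P (Suc (Suc k)) \<Longrightarrow> w (Suc (Suc k)) - 2 * w (Suc k) + w k \<le> c"
  shows "(\<Sum>k<N. if P k \<and> P (Suc k) then ((v (Suc k) - w (Suc k)) - (v k - w k))\<^sup>2 else 0)
    \<le> E * (8 * M + 4 * c * real N)"
proof -
  have "(\<forall>k\<le>N. \<not> P k) \<or> (\<exists>p n. p + n \<le> N \<and> (\<forall>k\<le>N. P k \<longleftrightarrow> p \<le> k \<and> k \<le> p + n))"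
    by (rule interval_pred_nat_cases) (fact P)
  then consider (empty) "\<And>k. k \<le> N \<Longrightarrow> \<not> P k"
    | (run) p n where "p + n \<le> N" "\<And>k. k \<le> N \<Longrightarrow> P k \<longleftrightarrow> p \<le> k \<and> k \<le> p + n"
    by metis
  then show ?thesis
  proof cases
    case empty
    then show ?thesis using M c E0 by (simp add: sum.neutral)
  next
    case (run p n)
    let ?d = "\<lambda>k. ((v (Suc k) - w (Suc k)) - (v k - w k))\<^sup>2"
    have in_run: "P (p + k)" if "k \<le> n" for k using run that by simp
    have "(\<Sum>k<N. if P k \<and> P (Suc k) then ?d k else 0) = (\<Sum>k\<in>{k. k < N \<and> P k \<and> P (Suc k)}. ?d k)"
      by (subst sum.inter_filter[symmetric]) auto
    also have "{k. k < N \<and> P k \<and> P (Suc k)} = (+) p ` {..<n}"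
    proof (intro equalityI subsetI)
      fix k assume "k \<in> {k. k < N \<and> P k \<and> P (Suc k)}"
      then have "p \<le> k" "Suc k \<le> p + n" using run(2)[of k] run(2)[of "Suc k"] by auto
      then show "k \<in> (+) p ` {..<n}" by (intro image_eqI[of _ _ "k - p"]) auto
    next
      fix k assume "k \<in> (+) p ` {..<n}"
      then obtain j where "k = p + j" "j < n" by auto
      then show "k \<in> {k. k < N \<and> P k \<and> P (Suc k)}"
        using run(1) in_run[of j] in_run[of "Suc j"] by auto
    qed
    also have "(\<Sum>k\<in>\<dots>. ?d k) = (\<Sum>k<n. ?d (p + k))"
      by (subst sum.reindex) (auto simp: inj_on_def)
    also have "\<dots> \<le> E * (8 * M + 4 * c * real n)"
    proof -
      have "\<bar>v (p + k) - w (p + k)\<bar> \<le> E" if "k \<le> n" for k using E in_run that by simp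
      moreover have "\<bar>v (p + Suc k) - v (p + k)\<bar> \<le> M" "\<bar>w (p + Suc k) - w (p + k)\<bar> \<le> M"
        if "Suc k \<le> n" for k
        using v(1)[of "p + k"] w(1)[of "p + k"] in_run[of k] in_run[of "Suc k"] that by simp_all
      moreover have "v (p + Suc (Suc k)) - 2 * v (p + Suc k) + v (p + k) \<le> c"
        "w (p + Suc (Suc k)) - 2 * w (p + Suc k) + w (p + k) \<le> c" if "Suc (Suc k) \<le> n" for k
        using v(2)[of "p + k"] w(2)[of "p + k"] in_run[of k] in_run[of "Suc (Suc k)"] that by simp_all
      ultimately show ?thesis
        using sum_squares_diff_le[OF M c, of n "\<lambda>k. v (p + k)" "\<lambda>k. w (p + k)" E] by simp
    qed
    also have "\<dots> \<le> E * (8 * M + 4 * c * real N)"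
      using run(1) c E0 by (intro mult_left_mono add_left_mono) auto
    finally show ?thesis .
  qed
qed

section \<open>Averaging over translates along a progression\<close>

lemma nn_integral_lborel_translate:
  fixes F :: "'a::euclidean_space \<Rightarrow> ennreal"
  assumes [measurable]: "F \<in> borel_measurable borel"
  shows "(\<integral>\<^sup>+x. F (x + a) \<partial>lborel) = (\<integral>\<^sup>+x. F x \<partial>lborel)"
proof -
  have "(\<integral>\<^sup>+x. F x \<partial>lborel) = (\<integral>\<^sup>+x. F x \<partial>distr lborel borel ((+) a))"
    unfolding lborel_distr_plus ..
  also have "\<dots> = (\<integral>\<^sup>+x. F (a + x) \<partial>lborel)"
    by (rule nn_integral_distr) measurable
  finally show ?thesis unfolding add.commute[of _ a] ..
qed

text \<open>All translates have the same integral, so \<open>N\<close> times that integral is the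
  integral of the sum along a progression. The shifts have length at most 1, so this sum vanishes
  outside the ball of radius \<open>R + 1\<close>.\<close>

lemma nn_integral_translates_le:
  fixes F :: "'a::euclidean_space \<Rightarrow> ennreal"
  assumes F[measurable]: "F \<in> borel_measurable borel" and b: "norm b \<le> 1"
    and supp: "\<And>x. F x \<noteq> 0 \<Longrightarrow> norm x < R"
    and bound: "\<And>x. (\<Sum>k<N. F (x + (real k / real N) *\<^sub>R b)) \<le> M"
  shows "of_nat N * (\<integral>\<^sup>+x. F x \<partial>lborel) \<le> M * emeasure lborel (ball (0::'a) (R + 1))"
proof -
  have "of_nat N * (\<integral>\<^sup>+x. F x \<partial>lborel) = (\<Sum>k<N. \<integral>\<^sup>+x. F (x + (real k / real N) *\<^sub>R b) \<partial>lborel)"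
    by (simp add: nn_integral_lborel_translate)
  also have "\<dots> = (\<integral>\<^sup>+x. (\<Sum>k<N. F (x + (real k / real N) *\<^sub>R b)) \<partial>lborel)"
    by (subst nn_integral_sum) auto
  also have "\<dots> \<le> (\<integral>\<^sup>+x. M * indicator (ball (0::'a) (R + 1)) x \<partial>lborel)"
  proof (intro nn_integral_mono)
    fix x :: 'a
    show "(\<Sum>k<N. F (x + (real k / real N) *\<^sub>R b)) \<le> M * indicator (ball 0 (R + 1)) x"
    proof (cases "x \<in> ball 0 (R + 1)")
      case True
      then show ?thesis using bound by simp
    next
      case False
      have "F (x + (real k / real N) *\<^sub>R b) = 0" if "k < N" for k
      proof (rule ccontr)
        assume "F (x + (real k / real N) *\<^sub>R b) \<noteq> 0"
        then have "norm (x + (real k / real N) *\<^sub>R b) < R" using supp by blast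
        moreover have "norm ((real k / real N) *\<^sub>R b) \<le> 1"
          using b that mult_mono[of "real k" "real N" "norm b" 1] by (simp add: field_simps)
        moreover have "norm x \<le> norm (x + (real k / real N) *\<^sub>R b) + norm ((real k / real N) *\<^sub>R b)"
          by (metis add_diff_cancel norm_triangle_ineq4)
        ultimately show False using False by auto
      qed
      then show ?thesis by (simp add: sum.neutral)
    qed
  qed
  also have "\<dots> = M * emeasure lborel (ball (0::'a) (R + 1))"
    by (subst nn_integral_cmult_indicator) auto
  finally show ?thesis .
qed

section \<open>Differentiability of concave functions\<close>

text \<open>The epigraph of \<open>- f\<close> is separated from the open vertical ray below
  \<open>(x, - f x)\<close>. The hyperplane cannot be vertical: then all of \<open>S\<close> would
  lie on one side of \<open>x\<close>, although \<open>S\<close> contains a ball around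
  \<open>x\<close>. Its slope is therefore a supergradient.\<close>

lemma concave_on_supergradient:
  fixes f :: "'a::euclidean_space \<Rightarrow> real"
  assumes f: "concave_on S f" and S: "open S" and x: "x \<in> S"
  obtains p where "\<And>y. y \<in> S \<Longrightarrow> f y \<le> f x + p \<bullet> (y - x)"
proof -
  let ?A = "epigraph S (\<lambda>y. - f y)" and ?B = "{x} \<times> {..< - f x}"
  have "convex ?A" using f by (simp add: convex_epigraph concave_on_def)
  moreover have "convex ?B" by (intro convex_Times) auto
  moreover have "(x, - f x) \<in> ?A" using x by (simp add: epigraph_def)
  then have "?A \<noteq> {}" by blast
  moreover have "(x, - f x - 1) \<in> ?B" by simp
  then have "?B \<noteq> {}" by blast
  moreover have "?A \<inter> ?B = {}" by (auto simp: epigraph_def)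
  ultimately obtain a c where a: "a \<noteq> 0" and A: "\<And>z. z \<in> ?A \<Longrightarrow> a \<bullet> z \<le> c" and B: "\<And>z. z \<in> ?B \<Longrightarrow> c \<le> a \<bullet> z"
    using separating_hyperplane_sets[of ?A ?B] by metis
  obtain \<alpha> \<beta> where ab: "a = (\<alpha>, \<beta>)" by (cases a)
  have key: "\<alpha> \<bullet> (y - x) + \<beta> * (t + f x + e) \<le> 0" if "y \<in> S" "- f y \<le> t" "0 < e" for y t e
  proof -
    have "a \<bullet> (y, t) \<le> c" using A[of "(y, t)"] that by (simp add: epigraph_def)
    moreover have "c \<le> a \<bullet> (x, - f x - e)" using B[of "(x, - f x - e)"] that by simp
    ultimately show ?thesis unfolding ab by (simp add: inner_diff_right algebra_simps)
  qed
  have "\<beta> \<le> 0" using key[of x "- f x" 1] x by simp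
  moreover have "\<beta> \<noteq> 0"
  proof
    assume b0: "\<beta> = 0"
    obtain r where r: "0 < r" "ball x r \<subseteq> S" using S x open_contains_ball by blast
    define s where "s = r / (2 * (norm \<alpha> + 1))"
    have n: "norm \<alpha> + 1 > 0" using norm_ge_zero[of \<alpha>] by linarith
    then have s: "0 < s" unfolding s_def using r by simp
    have "s * norm \<alpha> < r" unfolding s_def using r n by (simp add: field_simps add_nonneg_pos)
    then have "x + s *\<^sub>R \<alpha> \<in> S" using r s by (auto simp: dist_norm intro!: subsetD[OF r(2)])
    then have "s * (\<alpha> \<bullet> \<alpha>) \<le> 0" using key[of "x + s *\<^sub>R \<alpha>" "- f (x + s *\<^sub>R \<alpha>)" 1] b0 by simp
    then have "\<alpha> = 0" using s by (metis inner_ge_zero inner_eq_zero_iff mult_le_cancel_left_pos mult_zero_right order_antisym)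
    then show False using a ab b0 by (simp add: zero_prod_def)
  qed
  ultimately have b: "\<beta> < 0" by simp
  show ?thesis
  proof (rule that[of "(1 / \<beta>) *\<^sub>R \<alpha>"])
    fix y assume y: "y \<in> S"
    \<comment> \<open>The ray excludes its end point, so \<open>key\<close> carries a positive
      slack. With the slack \<open>e / (- \<beta>)\<close> it contributes exactly \<open>e\<close>
      and is removed by letting \<open>e\<close> tend to 0.\<close>
    have "\<alpha> \<bullet> (y - x) + \<beta> * (f x - f y) \<le> 0 + e" if "0 < e" for e
    proof -
      have "\<beta> * (e / (- \<beta>)) = - e" using b by simp
      moreover have "\<alpha> \<bullet> (y - x) + \<beta> * (- f y + f x + e / (- \<beta>)) \<le> 0"
        using y that b by (intro key) (auto simp: divide_pos_neg)
      ultimately show ?thesis by (simp add: distrib_left right_diff_distrib)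
    qed
    then have "\<alpha> \<bullet> (y - x) + \<beta> * (f x - f y) \<le> 0" by (rule field_le_epsilon)
    then show "f y \<le> f x + (1 / \<beta>) *\<^sub>R \<alpha> \<bullet> (y - x)" using b by (simp add: field_simps)
  qed
qed

text \<open>A small symmetric second difference at the single scale \<open>h\<close> controls all
  smaller scales. The supergradient bounds the value at \<open>x - h *\<^sub>R c\<close> from above,
  so the gap forces a lower bound at \<open>x + h *\<^sub>R c\<close>, and concavity interpolates it
  linearly back to \<open>x\<close>.\<close>

lemma concave_on_ray_lower_bound:
  fixes f :: "'a::euclidean_space \<Rightarrow> real"
  assumes f: "concave_on S f" and S: "x \<in> S" "x + h *\<^sub>R c \<in> S" "x - h *\<^sub>R c \<in> S"
    and p: "\<And>y. y \<in> S \<Longrightarrow> f y \<le> f x + p \<bullet> (y - x)"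
    and gap: "2 * f x - f (x + h *\<^sub>R c) - f (x - h *\<^sub>R c) \<le> e * h" and s: "0 \<le> s" "s \<le> h" and h: "0 < h"
  shows "x + s *\<^sub>R c \<in> S \<and> f x + s * (p \<bullet> c) - s * e \<le> f (x + s *\<^sub>R c)"
proof -
  have eq: "x + s *\<^sub>R c = (1 - s / h) *\<^sub>R x + (s / h) *\<^sub>R (x + h *\<^sub>R c)"
    using h by (simp add: algebra_simps)
  have sh: "0 \<le> s / h" "s / h \<le> 1" using s h by auto
  have "convex S" using f by (rule concave_on_imp_convex)
  then have mem: "x + s *\<^sub>R c \<in> S"
    unfolding eq using S sh by (intro convexD_alt) auto
  have "f (x - h *\<^sub>R c) \<le> f x - h * (p \<bullet> c)" using p[OF S(3)] by simp
  then have up: "f x + h * (p \<bullet> c) - e * h \<le> f (x + h *\<^sub>R c)" using gap by linarith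
  have "f x + s * (p \<bullet> c) - s * e = (1 - s / h) * f x + (s / h) * (f x + h * (p \<bullet> c) - e * h)"
    using h by (simp add: field_simps)
  also have "\<dots> \<le> (1 - s / h) * f x + (s / h) * f (x + h *\<^sub>R c)"
    using up sh by (intro add_left_mono mult_left_mono) auto
  also have "\<dots> \<le> f (x + s *\<^sub>R c)"
    unfolding eq using concave_onD[OF f sh S(1,2)] .
  finally show ?thesis using mem by simp
qed

text \<open>One good scale for each \<open>e\<close> is enough, because concavity carries the bound
  to all smaller scales; hence smallness along a subsequence of step sizes suffices. The derivative
  is any supergradient \<open>p\<close>: it bounds \<open>f\<close> from above, and only the lower
  bound needs the second differences.\<close>

lemma concave_on_gderiv_of_second_differences:
  fixes f :: "'a::euclidean_space \<Rightarrow> real"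
  assumes f: "concave_on S f" and S: "open S" and x: "x \<in> S"
    and gap: "\<And>e. 0 < e \<Longrightarrow> \<exists>h>0. (\<forall>b\<in>Basis. x + h *\<^sub>R b \<in> S \<and> x - h *\<^sub>R b \<in> S) \<and>
      (\<Sum>b\<in>Basis. 2 * f x - f (x + h *\<^sub>R b) - f (x - h *\<^sub>R b)) \<le> e * h"
  shows "\<exists>p. GDERIV f x :> p"
proof -
  obtain p where p: "\<And>y. y \<in> S \<Longrightarrow> f y \<le> f x + p \<bullet> (y - x)"
    using concave_on_supergradient[OF f S x] by blast
  define d where "d = real DIM('a)"
  have d: "0 < d" unfolding d_def by simp
  have "\<exists>\<delta>>0. \<forall>y. norm (y - x) < \<delta> \<longrightarrow> norm (f y - f x - (y - x) \<bullet> p) \<le> e * norm (y - x)"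
    if e: "0 < e" for e
  proof -
    \<comment> \<open>The \<open>d\<close> coordinate directions contribute errors of at most
      \<open>e' * norm z\<close> each.\<close>
    define e' where "e' = e / d"
    have e': "0 < e'" using e d e'_def by simp
    obtain h where h: "0 < h" and mem: "\<And>b. b \<in> Basis \<Longrightarrow> x + h *\<^sub>R b \<in> S \<and> x - h *\<^sub>R b \<in> S"
      and sum: "(\<Sum>b\<in>Basis. 2 * f x - f (x + h *\<^sub>R b) - f (x - h *\<^sub>R b)) \<le> e' * h"
      using gap[OF e'] by blast
    have each: "2 * f x - f (x + h *\<^sub>R b) - f (x - h *\<^sub>R b) \<le> e' * h" if b: "b \<in> Basis" for b
    proof -
      have pos: "0 \<le> 2 * f x - f (x + h *\<^sub>R b) - f (x - h *\<^sub>R b)" if "b \<in> Basis" for b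
        using p[of "x + h *\<^sub>R b"] p[of "x - h *\<^sub>R b"] mem[OF that] by simp
      show ?thesis
        using sum member_le_sum[OF b, of "\<lambda>b. 2 * f x - f (x + h *\<^sub>R b) - f (x - h *\<^sub>R b)"] pos by fastforce
    qed
    have dir: "x + s *\<^sub>R b \<in> S \<and> f x + s * (p \<bullet> b) - \<bar>s\<bar> * e' \<le> f (x + s *\<^sub>R b)"
      if b: "b \<in> Basis" and s: "\<bar>s\<bar> \<le> h" for b s
    proof (cases "0 \<le> s")
      case True
      then show ?thesis
        using concave_on_ray_lower_bound[OF f x _ _ p each[OF b], of s] mem[OF b] s h by simp
    next
      case False
      have "2 * f x - f (x + h *\<^sub>R (- b)) - f (x - h *\<^sub>R (- b)) \<le> e' * h" using each[OF b] by simp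
      then show ?thesis
        using concave_on_ray_lower_bound[OF f x _ _ p, of h "- b" e' "- s"] mem[OF b] s h False by simp
    qed
    have "norm (f y - f x - (y - x) \<bullet> p) \<le> e * norm (y - x)" if y: "norm (y - x) < h / d" for y
    proof -
      define z where "z = y - x"
      have zb: "\<bar>z \<bullet> b\<bar> \<le> norm z" if "b \<in> Basis" for b using that by (rule Basis_le_norm)
      have small: "\<bar>d * (z \<bullet> b)\<bar> \<le> h" if "b \<in> Basis" for b
      proof -
        have "\<bar>d * (z \<bullet> b)\<bar> \<le> d * norm z" using zb[OF that] d by (simp add: abs_mult)
        also have "\<dots> \<le> h" using y d unfolding z_def by (simp add: field_simps)
        finally show ?thesis .
      qed
      \<comment> \<open>To pass from the axes to an arbitrary direction, \<open>y\<close> is written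
        as the mean of \<open>d\<close> points on the axes through \<open>x\<close>, each displaced
        by \<open>d\<close> times a coordinate of \<open>z\<close>. The radius \<open>h / d\<close>
        keeps these displacements within \<open>h\<close>, and concavity bounds \<open>f y\<close>
        from below by the mean of the values.\<close>
      have y_eq: "y = (\<Sum>b\<in>Basis. (1 / d) *\<^sub>R (x + (d * (z \<bullet> b)) *\<^sub>R b))"
      proof -
        have "(\<Sum>b\<in>Basis. (1 / d) *\<^sub>R (x + (d * (z \<bullet> b)) *\<^sub>R b)) = (\<Sum>b\<in>(Basis::'a set). (1 / d) *\<^sub>R x) + (\<Sum>b\<in>Basis. (z \<bullet> b) *\<^sub>R b)"
          using d by (simp add: scaleR_add_right sum.distrib)
        also have "\<dots> = x + z" using d by (simp add: euclidean_representation sum_constant_scaleR d_def)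
        finally show ?thesis unfolding z_def by simp
      qed
      have one: "(\<Sum>b\<in>(Basis::'a set). 1 / d) = 1" using d unfolding d_def by simp
      have yS: "y \<in> S"
        unfolding y_eq using one d dir small concave_on_imp_convex[OF f]
        by (intro convex_sum) auto
      have conv: "convex_on S (\<lambda>y. - f y)" using f by (simp add: concave_on_def)
      have "- f y \<le> (\<Sum>b\<in>Basis. (1 / d) * - f (x + (d * (z \<bullet> b)) *\<^sub>R b))"
        unfolding y_eq using one d dir small
        by (intro convex_on_sum[OF _ _ conv]) auto
      also have "\<dots> \<le> (\<Sum>b\<in>Basis. (1 / d) * - (f x + d * (z \<bullet> b) * (p \<bullet> b) - \<bar>d * (z \<bullet> b)\<bar> * e'))"
      proof (intro sum_mono mult_left_mono)
        fix b :: 'a assume b: "b \<in> Basis"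
        show "- f (x + (d * (z \<bullet> b)) *\<^sub>R b) \<le> - (f x + d * (z \<bullet> b) * (p \<bullet> b) - \<bar>d * (z \<bullet> b)\<bar> * e')"
          using dir[OF b small[OF b]] by linarith
      qed (use d in simp)
      also have "\<dots> = (\<Sum>b\<in>(Basis::'a set). (1 / d) * - f x) - (\<Sum>b\<in>Basis. (z \<bullet> b) * (p \<bullet> b)) + (\<Sum>b\<in>Basis. \<bar>z \<bullet> b\<bar> * e')"
        unfolding sum_subtractf[symmetric] sum.distrib[symmetric]
        using d by (intro sum.cong) (auto simp: field_simps abs_mult)
      also have "(\<Sum>b\<in>(Basis::'a set). (1 / d) * - f x) = - f x"
        unfolding sum_distrib_right[symmetric] one by simp
      also have "(\<Sum>b\<in>Basis. (z \<bullet> b) * (p \<bullet> b)) = z \<bullet> p" by (rule euclidean_inner[symmetric])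
      also have "(\<Sum>b\<in>Basis. \<bar>z \<bullet> b\<bar> * e') \<le> (\<Sum>b\<in>(Basis::'a set). norm z * e')"
        using zb e' by (intro sum_mono mult_right_mono) auto
      also have "\<dots> = e * norm z" using d unfolding e'_def d_def by simp
      finally have "f x + z \<bullet> p - e * norm z \<le> f y" by simp
      moreover have "f y \<le> f x + z \<bullet> p" using p[OF yS] by (simp add: z_def inner_commute)
      moreover have "0 \<le> e * norm z" using e by simp
      ultimately show ?thesis unfolding z_def real_norm_def abs_le_iff by linarith
    qed
    then show ?thesis using h d by (intro exI[of _ "h / d"]) auto
  qed
  then have "GDERIV f x :> p"
    unfolding gderiv_def has_derivative_at_alt by (auto intro: bounded_linear_inner_left)
  then show ?thesis by blast
qed

section \<open>Semiconcave functions along lines and almost everywhere differentiability\<close>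

lemma convex_line_between:
  fixes S :: "'a::real_vector set"
  assumes S: "convex S" and le: "r \<le> s" "s \<le> t" and mem: "x + r *\<^sub>R b \<in> S" "x + t *\<^sub>R b \<in> S"
  shows "x + s *\<^sub>R b \<in> S"
proof (cases "r = t")
  case True
  then show ?thesis using le mem by auto
next
  case False
  define u where "u = (s - r) / (t - r)"
  have u: "0 \<le> u" "u \<le> 1" using le False unfolding u_def by auto
  have "u * (t - r) = s - r" using False unfolding u_def by simp
  then have s: "s = (1 - u) * r + u * t" by (simp add: algebra_simps)
  have eq: "x + s *\<^sub>R b = (1 - u) *\<^sub>R (x + r *\<^sub>R b) + u *\<^sub>R (x + t *\<^sub>R b)"
    unfolding s by (simp add: algebra_simps)
  show ?thesis unfolding eq using u mem by (intro convexD_alt[OF S])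
qed

text \<open>Concavity at the midpoint of \<open>x - y\<close> and \<open>x + y\<close>; by the
  parallelogram identity the quadratic contributes exactly \<open>C * (norm y)^2\<close>.\<close>

lemma semiconcave_second_diff_le:
  fixes v :: "'a::euclidean_space \<Rightarrow> real"
  assumes v: "concave_on S (\<lambda>x. v x - C / 2 * (norm x)\<^sup>2)" and mem: "x - y \<in> S" "x + y \<in> S"
  shows "v (x + y) - 2 * v x + v (x - y) \<le> C * (norm y)\<^sup>2"
proof -
  have "(1 - 1/2) * (v (x - y) - C / 2 * (norm (x - y))\<^sup>2) + 1/2 * (v (x + y) - C / 2 * (norm (x + y))\<^sup>2)
      \<le> v ((1 - 1/2) *\<^sub>R (x - y) + (1/2) *\<^sub>R (x + y)) - C / 2 * (norm ((1 - 1/2) *\<^sub>R (x - y) + (1/2) *\<^sub>R (x + y)))\<^sup>2"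
    using mem by (intro concave_onD[OF v]) auto
  moreover have "(1 - 1/2) *\<^sub>R (x - y) + (1/2) *\<^sub>R (x + y) = x"
    by (simp add: algebra_simps flip: scaleR_add_left)
  moreover have "(norm (x - y))\<^sup>2 + (norm (x + y))\<^sup>2 = 2 * (norm x)\<^sup>2 + 2 * (norm y)\<^sup>2"
    by (simp add: power2_norm_eq_inner inner_add inner_diff inner_commute)
  then have "C / 2 * ((norm (x - y))\<^sup>2 + (norm (x + y))\<^sup>2) = C * (norm x)\<^sup>2 + C * (norm y)\<^sup>2"
    by (simp add: algebra_simps)
  ultimately show ?thesis by (simp add: algebra_simps)
qed

lemma nn_integral_translates_bound:
  fixes F :: "'a::euclidean_space \<Rightarrow> ennreal"
  assumes "F \<in> borel_measurable borel" "norm b \<le> 1" "0 < N" "0 \<le> M"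
    and "\<And>x. F x \<noteq> 0 \<Longrightarrow> norm x < R"
    and "\<And>x. (\<Sum>k<N. F (x + (real k / real N) *\<^sub>R b)) \<le> ennreal M"
  shows "(\<integral>\<^sup>+x. F x \<partial>lborel) \<le> ennreal (M * measure lborel (ball (0::'a) (R + 1)) / real N)"
proof -
  let ?I = "\<integral>\<^sup>+x. F x \<partial>lborel" and ?m = "measure lborel (ball (0::'a) (R + 1))"
  have "emeasure lborel (ball (0::'a) (R + 1)) = ennreal ?m"
    using emeasure_lborel_ball_finite[of "0::'a" "R + 1"] by (intro emeasure_eq_ennreal_measure) auto
  then have le: "of_nat N * ?I \<le> ennreal (M * ?m)"
    using nn_integral_translates_le[of F b R N "ennreal M"] assms by (simp add: ennreal_mult)
  have "?I = ennreal (1 / real N) * (of_nat N * ?I)"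
    using \<open>0 < N\<close> by (simp add: mult.assoc[symmetric] ennreal_of_nat_eq_real_of_nat ennreal_mult[symmetric])
  also have "\<dots> \<le> ennreal (1 / real N) * ennreal (M * ?m)"
    using le by (intro mult_left_mono) auto
  also have "\<dots> = ennreal (M * ?m / real N)"
    using assms by (simp add: ennreal_mult[symmetric])
  finally show ?thesis .
qed

lemma tendsto_inverse_Suc_scaleR:
  fixes b :: "'a::real_normed_vector"
  shows "(\<lambda>n. (1 / real (Suc n)) *\<^sub>R b) \<longlonglongrightarrow> 0"
  using tendsto_scaleR[OF LIMSEQ_inverse_real_of_nat tendsto_const[of b]] by (simp add: field_simps)

lemma eventually_translate_mem_open:
  fixes S :: "'a::real_normed_vector set"
  assumes "open S" "x \<in> S"
  shows "\<forall>\<^sub>F n in sequentially. x + (1 / real (Suc n)) *\<^sub>R b \<in> S"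
proof -
  have "(\<lambda>n. x + (1 / real (Suc n)) *\<^sub>R b) \<longlonglongrightarrow> x + 0"
    by (intro tendsto_add tendsto_const tendsto_inverse_Suc_scaleR)
  then show ?thesis using assms by (auto dest: topological_tendstoD)
qed

lemma lipschitz_on_translate_le:
  fixes f :: "'a::real_normed_vector \<Rightarrow> real"
  assumes "L-lipschitz_on S f" "x \<in> S" "y \<in> S" "y - x = h *\<^sub>R b" "norm b \<le> 1" "0 \<le> h"
  shows "\<bar>f y - f x\<bar> \<le> L * h"
proof -
  have "\<bar>f y - f x\<bar> \<le> L * norm (y - x)"
    using lipschitz_on_normD[OF assms(1,3,2)] by simp
  also have "\<dots> \<le> L * h"
    unfolding assms(4) using assms(5,6) lipschitz_on_nonneg[OF assms(1)]
    by (intro mult_left_mono) (auto intro: mult_left_le)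
  finally show ?thesis .
qed

lemma borel_measurable_extension_by_zero:
  fixes f :: "'a::topological_space \<Rightarrow> real"
  assumes "open S" "continuous_on S f"
  shows "(\<lambda>x. if x \<in> S then f x else 0) \<in> borel_measurable borel"
  using assms by (intro borel_measurable_continuous_on_if) auto

text \<open>The scaling decides: the absolute second differences with step \<open>h\<close> along a
  progression sum to at most \<open>2 * L * h\<close>. After division by \<open>h\<close> and
  averaging over the \<open>1 / h\<close> translates, the integral is of order \<open>h\<close> and
  disappears in the limit.\<close>

lemma concave_lipschitz_gderiv_AE:
  fixes f :: "'a::euclidean_space \<Rightarrow> real"
  assumes S: "open S" "bounded S" and f: "concave_on S f" and L: "L-lipschitz_on S f"
  shows "AE x in lborel. x \<in> S \<longrightarrow> (\<exists>p. GDERIV f x :> p)"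
proof -
  have conv: "convex S" using f by (rule concave_on_imp_convex)
  have L0: "0 \<le> L" using L by (rule lipschitz_on_nonneg)
  obtain R where R: "\<And>x. x \<in> S \<Longrightarrow> norm x < R" using bounded_pos_less[THEN iffD1, OF S(2)] by blast
  have [measurable]: "S \<in> sets borel" using S by auto
  \<comment> \<open>Shifted points may leave \<open>S\<close>. The extension by zero makes the
    shifted differences Borel on the whole space, while \<open>F\<close> takes a nonzero value only
    where all three points lie in \<open>S\<close>.\<close>
  define V where "V x = (if x \<in> S then f x else 0)" for x
  have [measurable]: "V \<in> borel_measurable borel"
    unfolding V_def[abs_def] using S(1) lipschitz_on_continuous_on[OF L] by (rule borel_measurable_extension_by_zero)
  define h where "h n = 1 / real (Suc n)" for n
  have h0: "0 < h n" for n unfolding h_def by simp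
  \<comment> \<open>As \<open>real (Suc n)\<close> is \<open>1 / h n\<close>, this is the symmetric
    second difference divided by the step, the quantity that the differentiability criterion
    requires to be small.\<close>
  define F where "F n b x = ennreal (if x - h n *\<^sub>R b \<in> S \<and> x + h n *\<^sub>R b \<in> S
      then real (Suc n) * \<bar>V (x + h n *\<^sub>R b) - 2 * V x + V (x - h n *\<^sub>R b)\<bar> else 0)" for n b x
  have [measurable]: "F n b \<in> borel_measurable borel" for n b
    unfolding F_def[abs_def] by measurable
  have mid: "x \<in> S" if "x - h n *\<^sub>R b \<in> S" "x + h n *\<^sub>R b \<in> S" for x n b
    using convex_line_between[OF conv, of "- h n" 0 "h n" x b] that h0[of n] by (simp add: less_imp_le)
  define B where "B = measure lborel (ball (0::'a) (R + 1))"
  have "0 \<le> B" unfolding B_def by simp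
  have int: "(\<integral>\<^sup>+x. F n b x \<partial>lborel) \<le> ennreal (2 * L * B * h n)" if b: "b \<in> Basis" for n b
  proof -
    have sum_le: "(\<Sum>k<Suc n. F n b (x + (real k / real (Suc n)) *\<^sub>R b)) \<le> ennreal (2 * L)" for x
    proof -
      \<comment> \<open>Second differences are centred, so the progression starts one step before
        \<open>x\<close>: the \<open>k\<close>-th translate of \<open>F\<close> is centred at
        \<open>pt (Suc k)\<close>.\<close>
      define pt where "pt k = x + ((real k - 1) * h n) *\<^sub>R b" for k
      define P where "P k \<longleftrightarrow> pt k \<in> S" for k
      define a where "a k = V (pt k)" for k
      have Pconv: "P j" if "i \<le> j" "j \<le> k" "P i" "P k" for i j k
        using convex_line_between[OF conv mult_right_mono mult_right_mono, of "real i - 1" "real j - 1" "h n" "real k - 1" x b]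
          that h0[of n] unfolding P_def pt_def by simp
      have c0: "x + (real k / real (Suc n)) *\<^sub>R b = pt (Suc k)" for k
        unfolding pt_def h_def by simp
      have c1: "pt (Suc k) - h n *\<^sub>R b = pt k" "pt (Suc k) + h n *\<^sub>R b = pt (Suc (Suc k))" for k
        unfolding pt_def by (simp_all add: algebra_simps)
      have lip: "\<bar>a (Suc k) - a k\<bar> \<le> L * h n" if "P k" "P (Suc k)" for k
      proof -
        have "pt (Suc k) - pt k = h n *\<^sub>R b" using c1(1)[of k] by (simp add: algebra_simps)
        then have "\<bar>f (pt (Suc k)) - f (pt k)\<bar> \<le> L * h n"
          using lipschitz_on_translate_le[OF L] that b h0[of n] unfolding P_def by simp
        then show ?thesis using that unfolding a_def V_def P_def by simp
      qed
      have conc: "a (Suc (Suc k)) - 2 * a (Suc k) + a k \<le> 0" if "P k" "P (Suc (Suc k))" for k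
      proof -
        have "concave_on S (\<lambda>x. f x - 0 / 2 * (norm x)\<^sup>2)" using f by simp
        from semiconcave_second_diff_le[OF this, of "pt (Suc k)" "h n *\<^sub>R b"]
        have "f (pt (Suc (Suc k))) - 2 * f (pt (Suc k)) + f (pt k) \<le> 0"
          using that unfolding c1 P_def by simp
        moreover have "P (Suc k)" using Pconv[of k "Suc k" "Suc (Suc k)"] that by simp
        ultimately show ?thesis using that unfolding a_def V_def P_def by simp
      qed
      have "(\<Sum>k<Suc n. F n b (x + (real k / real (Suc n)) *\<^sub>R b)) =
          (\<Sum>k<Suc n. ennreal (real (Suc n) * (if P k \<and> P (Suc (Suc k)) then \<bar>a (Suc (Suc k)) - 2 * a (Suc k) + a k\<bar> else 0)))"
        unfolding c0 F_def c1 P_def a_def by (intro sum.cong) auto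
      also have "\<dots> = ennreal (real (Suc n) * (\<Sum>k<Suc n. if P k \<and> P (Suc (Suc k)) then \<bar>a (Suc (Suc k)) - 2 * a (Suc k) + a k\<bar> else 0))"
        unfolding sum_distrib_left by (intro sum_ennreal) auto
      also have "\<dots> \<le> ennreal (real (Suc n) * (2 * (L * h n) + 2 * 0 * real (Suc (Suc n))))"
      proof (intro ennreal_leI mult_left_mono sum_abs_second_diff_le_interval)
        show "P j" if "i \<le> j" "j \<le> k" "P i" "P k" for i j k using that by (rule Pconv)
        show "\<bar>a (Suc k) - a k\<bar> \<le> L * h n" if "P k" "P (Suc k)" for k using that by (rule lip)
        show "a (Suc (Suc k)) - 2 * a (Suc k) + a k \<le> 0" if "P k" "P (Suc (Suc k))" for k
          using that by (rule conc)
      qed (use L0 h0[of n] in auto)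
      also have "\<dots> = ennreal (2 * L)" unfolding h_def by simp
      finally show ?thesis .
    qed
    have supp: "norm x < R" if "F n b x \<noteq> 0" for x
    proof (rule R)
      show "x \<in> S" using that mid[of x n b] unfolding F_def by (cases "x - h n *\<^sub>R b \<in> S \<and> x + h n *\<^sub>R b \<in> S") auto
    qed
    have "(\<integral>\<^sup>+x. F n b x \<partial>lborel) \<le> ennreal (2 * L * B / real (Suc n))"
      unfolding B_def
    proof (rule nn_integral_translates_bound[where b = b])
      show "norm x < R" if "F n b x \<noteq> 0" for x using that by (rule supp)
      show "(\<Sum>k<Suc n. F n b (x + (real k / real (Suc n)) *\<^sub>R b)) \<le> ennreal (2 * L)" for x by (rule sum_le)
    qed (use b L0 in simp_all)
    then show ?thesis unfolding h_def by simp
  qed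
  define G where "G n x = (\<Sum>b\<in>Basis. F n b x)" for n x
  have [measurable]: "G n \<in> borel_measurable borel" for n unfolding G_def[abs_def] by measurable
  have "(\<integral>\<^sup>+x. liminf (\<lambda>n. G n x) \<partial>lborel) \<le> liminf (\<lambda>n. \<integral>\<^sup>+x. G n x \<partial>lborel)"
    by (rule nn_integral_liminf) measurable
  also have "\<dots> \<le> liminf (\<lambda>n. ennreal (real DIM('a) * (2 * L * B) * h n))"
  proof (intro Liminf_mono always_eventually allI)
    fix n
    have "(\<integral>\<^sup>+x. G n x \<partial>lborel) = (\<Sum>b\<in>Basis. \<integral>\<^sup>+x. F n b x \<partial>lborel)"
      unfolding G_def by (rule nn_integral_sum) measurable
    also have "\<dots> \<le> (\<Sum>b\<in>(Basis::'a set). ennreal (2 * L * B * h n))"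
      by (intro sum_mono int)
    also have "\<dots> = ennreal (real DIM('a) * (2 * L * B) * h n)"
      using L0 \<open>0 \<le> B\<close> h0[of n] by (simp add: ennreal_of_nat_eq_real_of_nat ennreal_mult[symmetric] mult.assoc)
    finally show "(\<integral>\<^sup>+x. G n x \<partial>lborel) \<le> ennreal (real DIM('a) * (2 * L * B) * h n)" .
  qed
  also have "\<dots> = 0"
  proof (intro lim_imp_Liminf)
    have "(\<lambda>n. real DIM('a) * (2 * L * B) * h n) \<longlonglongrightarrow> real DIM('a) * (2 * L * B) * 0"
      unfolding h_def using LIMSEQ_inverse_real_of_nat by (intro tendsto_mult tendsto_const) (simp add: field_simps)
    from tendsto_ennrealI[OF this]
    show "(\<lambda>n. ennreal (real DIM('a) * (2 * L * B) * h n)) \<longlonglongrightarrow> 0" by simp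
  qed simp
  finally have "(\<integral>\<^sup>+x. liminf (\<lambda>n. G n x) \<partial>lborel) = 0" by simp
  then have "AE x in lborel. liminf (\<lambda>n. G n x) = 0"
    by (subst (asm) nn_integral_0_iff_AE) auto
  then show ?thesis
  proof (rule eventually_mono, intro impI)
    fix x assume lim: "liminf (\<lambda>n. G n x) = 0" and x: "x \<in> S"
    show "\<exists>p. GDERIV f x :> p"
    proof (rule concave_on_gderiv_of_second_differences[OF f S(1) x])
      fix e :: real assume e: "0 < e"
      \<comment> \<open>A vanishing liminf makes \<open>G n x\<close> small only for infinitely many
        \<open>n\<close>, which is enough because the criterion asks for a single step size.\<close>
      have freq: "\<exists>\<^sub>F n in sequentially. G n x < ennreal e"
      proof (rule ccontr)
        assume "\<not> ?thesis"
        then have "\<forall>\<^sub>F n in sequentially. ennreal e \<le> G n x" by (simp add: not_frequently not_less)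
        then have "ennreal e \<le> liminf (\<lambda>n. G n x)" by (rule Liminf_bounded)
        then show False using lim e by simp
      qed
      have ev: "\<forall>\<^sub>F n in sequentially. \<forall>b\<in>Basis. x + h n *\<^sub>R b \<in> S \<and> x - h n *\<^sub>R b \<in> S"
      proof (intro eventually_ball_finite ballI eventually_conj)
        fix b :: 'a
        show "\<forall>\<^sub>F n in sequentially. x + h n *\<^sub>R b \<in> S"
          unfolding h_def by (rule eventually_translate_mem_open[OF S(1) x])
        show "\<forall>\<^sub>F n in sequentially. x - h n *\<^sub>R b \<in> S"
          using eventually_translate_mem_open[OF S(1) x, of "- b"] unfolding h_def by simp
      qed simp
      obtain n where n: "G n x < ennreal e" and adm: "\<forall>b\<in>Basis. x + h n *\<^sub>R b \<in> S \<and> x - h n *\<^sub>R b \<in> S"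
        using frequently_ex[OF frequently_eventually_frequently[OF freq ev]] by blast
      have "G n x = (\<Sum>b\<in>Basis. ennreal (real (Suc n) * \<bar>f (x + h n *\<^sub>R b) - 2 * f x + f (x - h n *\<^sub>R b)\<bar>))"
        unfolding G_def F_def V_def using adm x by (intro sum.cong) auto
      also have "\<dots> = ennreal (real (Suc n) * (\<Sum>b\<in>Basis. \<bar>f (x + h n *\<^sub>R b) - 2 * f x + f (x - h n *\<^sub>R b)\<bar>))"
        unfolding sum_distrib_left by (intro sum_ennreal) auto
      finally have "real (Suc n) * (\<Sum>b\<in>Basis. \<bar>f (x + h n *\<^sub>R b) - 2 * f x + f (x - h n *\<^sub>R b)\<bar>) < e"
        using n by (simp add: ennreal_less_iff sum_nonneg)
      then have "(\<Sum>b\<in>Basis. \<bar>f (x + h n *\<^sub>R b) - 2 * f x + f (x - h n *\<^sub>R b)\<bar>) \<le> e * h n"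
        unfolding h_def by (simp add: field_simps)
      moreover have "(\<Sum>b\<in>Basis. 2 * f x - f (x + h n *\<^sub>R b) - f (x - h n *\<^sub>R b))
          \<le> (\<Sum>b\<in>Basis. \<bar>f (x + h n *\<^sub>R b) - 2 * f x + f (x - h n *\<^sub>R b)\<bar>)"
      proof (intro sum_mono)
        fix b :: 'a
        show "2 * f x - f (x + h n *\<^sub>R b) - f (x - h n *\<^sub>R b) \<le> \<bar>f (x + h n *\<^sub>R b) - 2 * f x + f (x - h n *\<^sub>R b)\<bar>"
          using abs_ge_minus_self[of "f (x + h n *\<^sub>R b) - 2 * f x + f (x - h n *\<^sub>R b)"] by simp
      qed
      ultimately show "\<exists>h>0. (\<forall>b\<in>Basis. x + h *\<^sub>R b \<in> S \<and> x - h *\<^sub>R b \<in> S) \<and>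
          (\<Sum>b\<in>Basis. 2 * f x - f (x + h *\<^sub>R b) - f (x - h *\<^sub>R b)) \<le> e * h"
        using adm h0[of n] by (intro exI[of _ "h n"]) auto
    qed
  qed
qed

section \<open>Gradients of semiconcave Lipschitz functions\<close>

lemma GDERIV_unique:
  assumes "GDERIV f x :> p" "GDERIV f x :> q"
  shows "p = q"
proof -
  have "(\<lambda>y. y \<bullet> p) = (\<lambda>y. y \<bullet> q)"
    using assms unfolding gderiv_def by (rule has_derivative_unique)
  then have "(p - q) \<bullet> p = (p - q) \<bullet> q" by (rule fun_cong)
  then have "(p - q) \<bullet> (p - q) = 0" by (simp add: inner_diff_right)
  then show ?thesis by simp
qed

lemma grad_eqI: "GDERIV f x :> p \<Longrightarrow> grad f x = p"
  unfolding grad_def by (rule the_equality) (auto intro: GDERIV_unique)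

lemma GDERIV_grad: "\<exists>p. GDERIV f x :> p \<Longrightarrow> GDERIV f x :> grad f x"
  using grad_eqI by metis

lemma GDERIV_imp_differentiable: "GDERIV f x :> p \<Longrightarrow> f differentiable at x"
  unfolding gderiv_def differentiable_def by blast

lemma GDERIV_half_norm_square:
  fixes x :: "'a::euclidean_space"
  shows "GDERIV (\<lambda>x. c / 2 * (norm x)\<^sup>2) x :> c *\<^sub>R x"
  unfolding gderiv_def power2_norm_eq_inner
  by (auto intro!: derivative_eq_intros simp: inner_commute algebra_simps)

lemma GDERIV_difference_quotient:
  fixes f :: "'a::euclidean_space \<Rightarrow> real"
  assumes f: "GDERIV f x :> p"
  shows "(\<lambda>n. real (Suc n) * (f (x + (1 / real (Suc n)) *\<^sub>R b) - f x)) \<longlonglongrightarrow> p \<bullet> b"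
proof -
  have line: "((\<lambda>t. x + t *\<^sub>R b) has_derivative (\<lambda>t. t *\<^sub>R b)) (at 0)"
    by (auto intro!: derivative_eq_intros)
  have "(f has_derivative (\<lambda>y. y \<bullet> p)) (at (x + 0 *\<^sub>R b))"
    using f by (simp add: gderiv_def)
  from diff_chain_at[OF line this] have "((\<lambda>t. f (x + t *\<^sub>R b)) has_derivative (\<lambda>t. t * (p \<bullet> b))) (at 0)"
    by (simp add: o_def inner_commute)
  then have "((\<lambda>t. f (x + t *\<^sub>R b)) has_field_derivative (p \<bullet> b)) (at 0)"
    unfolding has_field_derivative_def by (simp add: mult_commute_abs)
  then have lim: "((\<lambda>t. (f (x + t *\<^sub>R b) - f x) / t) \<longlongrightarrow> p \<bullet> b) (at 0)"
    by (simp add: DERIV_def)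
  have "filterlim (\<lambda>n. 1 / real (Suc n)) (at 0) sequentially"
    unfolding filterlim_at using LIMSEQ_inverse_real_of_nat by (simp add: field_simps)
  from filterlim_compose[OF lim this] show ?thesis by (simp add: mult.commute)
qed

lemma GDERIV_lipschitz_norm_le:
  fixes f :: "'a::euclidean_space \<Rightarrow> real"
  assumes S: "open S" "x \<in> S" and L: "L-lipschitz_on S f" and f: "GDERIV f x :> p"
  shows "norm p \<le> L"
proof (cases "p = 0")
  case True
  then show ?thesis using lipschitz_on_nonneg[OF L] by simp
next
  case False
  define b where "b = sgn p"
  have b: "norm b \<le> 1" "p \<bullet> b = norm p" using False unfolding b_def
    by (auto simp: norm_sgn sgn_div_norm power2_norm_eq_inner[symmetric] power2_eq_square)
  have "norm p \<le> L"
    unfolding b(2)[symmetric]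
  proof (rule tendsto_upperbound[OF GDERIV_difference_quotient[OF f]])
    show "\<forall>\<^sub>F n in sequentially. real (Suc n) * (f (x + (1 / real (Suc n)) *\<^sub>R b) - f x) \<le> L"
      using eventually_translate_mem_open[OF S, of b]
    proof eventually_elim
      case (elim n)
      have "\<bar>f (x + (1 / real (Suc n)) *\<^sub>R b) - f x\<bar> \<le> L * (1 / real (Suc n))"
        by (rule lipschitz_on_translate_le[OF L S(2) elim _ b(1)]) simp_all
      then have "f (x + (1 / real (Suc n)) *\<^sub>R b) - f x \<le> L * (1 / real (Suc n))" by simp
      then show ?case by (simp add: field_simps)
    qed
  qed simp
  then show ?thesis .
qed

lemma lipschitz_on_half_norm_square:
  fixes S :: "'a::real_inner set"
  assumes "\<And>x. x \<in> S \<Longrightarrow> norm x \<le> R" "0 \<le> R" "0 \<le> C"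
  shows "(C * R)-lipschitz_on S (\<lambda>x. C / 2 * (norm x)\<^sup>2)"
proof (rule lipschitz_onI)
  fix x y assume xy: "x \<in> S" "y \<in> S"
  have "\<bar>(norm x)\<^sup>2 - (norm y)\<^sup>2\<bar> = \<bar>norm x - norm y\<bar> * (norm x + norm y)"
    by (simp add: square_diff_square_factored power2_eq_square abs_mult)
  also have "\<dots> \<le> norm (x - y) * (R + R)"
    using assms xy by (intro mult_mono norm_triangle_ineq3 add_mono) auto
  finally have "C / 2 * \<bar>(norm x)\<^sup>2 - (norm y)\<^sup>2\<bar> \<le> C / 2 * (norm (x - y) * (R + R))"
    using assms by (intro mult_left_mono) auto
  moreover have "dist (C / 2 * (norm x)\<^sup>2) (C / 2 * (norm y)\<^sup>2) = C / 2 * \<bar>(norm x)\<^sup>2 - (norm y)\<^sup>2\<bar>"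
    using assms(3) unfolding dist_real_def right_diff_distrib[symmetric] abs_mult by simp
  ultimately show "dist (C / 2 * (norm x)\<^sup>2) (C / 2 * (norm y)\<^sup>2) \<le> C * R * dist x y"
    by (simp add: dist_norm algebra_simps)
qed (use assms in auto)

text \<open>Subtracting the quadratic reduces this to the concave case: the quadratic is
  differentiable everywhere, and Lipschitz because \<open>S\<close> is bounded.\<close>

lemma semiconcave_lipschitz_gderiv_AE:
  fixes v :: "'a::euclidean_space \<Rightarrow> real"
  assumes S: "open S" "bounded S" and C: "0 \<le> C" and L: "L-lipschitz_on S v"
    and v: "concave_on S (\<lambda>x. v x - C / 2 * (norm x)\<^sup>2)"
  shows "AE x in lborel. x \<in> S \<longrightarrow> GDERIV v x :> grad v x"
proof -
  obtain R where R: "0 < R" "\<And>x. x \<in> S \<Longrightarrow> norm x \<le> R"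
    using bounded_pos[THEN iffD1, OF S(2)] by blast
  let ?q = "\<lambda>x::'a. C / 2 * (norm x)\<^sup>2"
  have "(C * R)-lipschitz_on S ?q" using R C by (intro lipschitz_on_half_norm_square) auto
  with L have "(L + C * R)-lipschitz_on S (\<lambda>x. v x - ?q x)" by (rule lipschitz_on_diff)
  from concave_lipschitz_gderiv_AE[OF S v this] show ?thesis
  proof (rule eventually_mono, intro impI GDERIV_grad)
    fix x assume "x \<in> S \<longrightarrow> (\<exists>p. GDERIV (\<lambda>x. v x - ?q x) x :> p)" "x \<in> S"
    then obtain p where "GDERIV (\<lambda>x. v x - ?q x) x :> p" by blast
    from GDERIV_add[OF this GDERIV_half_norm_square[of C x]] show "\<exists>p. GDERIV v x :> p" by auto
  qed
qed

text \<open>\<open>grad v\<close> has an unspecified value where \<open>v\<close> is not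
  differentiable. On \<open>S\<close> it agrees almost everywhere with a Borel function built from
  limits of difference quotients, and completeness of Lebesgue measure transfers
  measurability.\<close>

lemma semiconcave_lipschitz_grad_measurable:
  fixes v :: "'a::euclidean_space \<Rightarrow> real"
  assumes S: "open S" "bounded S" and C: "0 \<le> C" and L: "L-lipschitz_on S v"
    and v: "concave_on S (\<lambda>x. v x - C / 2 * (norm x)\<^sup>2)"
  shows "grad v \<in> borel_measurable (lebesgue_on S)"
proof -
  have [measurable]: "S \<in> sets borel" using S by auto
  have Sleb: "S \<in> sets lebesgue" by (simp add: sets_completionI_sets)
  define V where "V x = (if x \<in> S then v x else 0)" for x
  have [measurable]: "V \<in> borel_measurable borel"
    unfolding V_def[abs_def] using S(1) lipschitz_on_continuous_on[OF L] by (rule borel_measurable_extension_by_zero)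
  define q where "q b n x = real (Suc n) * (V (x + (1 / real (Suc n)) *\<^sub>R b) - V x)" for b n x
  have [measurable]: "q b n \<in> borel_measurable borel" for b n
    unfolding q_def[abs_def] by measurable
  define g where "g x = (if x \<in> S then (\<Sum>b\<in>Basis. lim (\<lambda>n. q b n x) *\<^sub>R b) else 0)" for x
  have "g \<in> borel_measurable borel" unfolding g_def[abs_def] by measurable
  then have g: "g \<in> borel_measurable lebesgue" by (intro measurable_completion) simp
  have "AE x in lborel. g x = (if x \<in> S then grad v x else 0)"
    using semiconcave_lipschitz_gderiv_AE[OF S C L v]
  proof (rule eventually_mono)
    fix x assume x: "x \<in> S \<longrightarrow> GDERIV v x :> grad v x"
    show "g x = (if x \<in> S then grad v x else 0)"
    proof (cases "x \<in> S")
      case True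
      have "lim (\<lambda>n. q b n x) = grad v x \<bullet> b" for b
      proof (rule limI)
        have "\<forall>\<^sub>F n in sequentially. real (Suc n) * (v (x + (1 / real (Suc n)) *\<^sub>R b) - v x) = q b n x"
          using eventually_translate_mem_open[OF S(1) True, of b]
          by eventually_elim (simp add: q_def V_def True)
        then show "(\<lambda>n. q b n x) \<longlonglongrightarrow> grad v x \<bullet> b"
          using GDERIV_difference_quotient[of v x "grad v x" b] x True by (auto elim: Lim_transform_eventually)
      qed
      then show ?thesis using True by (simp add: g_def euclidean_representation)
    qed (simp add: g_def)
  qed
  then have "AE x in lebesgue. g x = (if x \<in> S then grad v x else 0)" by (rule AE_completion)
  with g have "(\<lambda>x. if x \<in> S then grad v x else 0) \<in> borel_measurable lebesgue"
    by (rule borel_measurable_AE)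
  then show ?thesis using borel_measurable_if[OF Sleb] by blast
qed

text \<open>With step \<open>h\<close> the first differences are at most \<open>L * h\<close> and
  the second differences at most \<open>C * h^2\<close>, so over \<open>1 / h\<close> steps the
  squared differences of \<open>v - w\<close> sum to at most \<open>E * (8 * L + 4 * C) * h\<close>.
  Division by \<open>h^2\<close> and averaging over the \<open>1 / h\<close> translates cancel all
  powers of \<open>h\<close>; the dimension counts the coordinate directions.\<close>

lemma semiconcave_gradient_L2_estimate:
  fixes v w :: "'a::euclidean_space \<Rightarrow> real"
  assumes S: "open S" and R: "\<And>x. x \<in> S \<Longrightarrow> norm x < R" and C: "0 \<le> C" and E0: "0 \<le> E"
    and vL: "L-lipschitz_on S v" and v: "concave_on S (\<lambda>x. v x - C / 2 * (norm x)\<^sup>2)"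
    and wL: "L-lipschitz_on S w" and w: "concave_on S (\<lambda>x. w x - C / 2 * (norm x)\<^sup>2)"
    and E: "\<And>x. x \<in> S \<Longrightarrow> \<bar>v x - w x\<bar> \<le> E"
  shows "(\<integral>\<^sup>+x. ennreal (if x \<in> S then (norm (grad v x - grad w x))\<^sup>2 else 0) \<partial>lborel)
    \<le> ennreal (real DIM('a) * (E * (8 * L + 4 * C)) * measure lborel (ball (0::'a) (R + 1)))"
proof -
  have bS: "bounded S" using R unfolding bounded_iff by (meson less_imp_le)
  have conv: "convex S" using v by (rule concave_on_imp_convex)
  have L0: "0 \<le> L" using vL by (rule lipschitz_on_nonneg)
  have [measurable]: "S \<in> sets borel" using S by auto
  define V where "V x = (if x \<in> S then v x else 0)" for x
  have [measurable]: "V \<in> borel_measurable borel"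
    unfolding V_def[abs_def] using S lipschitz_on_continuous_on[OF vL] by (rule borel_measurable_extension_by_zero)
  define W where "W x = (if x \<in> S then w x else 0)" for x
  have [measurable]: "W \<in> borel_measurable borel"
    unfolding W_def[abs_def] using S lipschitz_on_continuous_on[OF wL] by (rule borel_measurable_extension_by_zero)
  define h where "h n = 1 / real (Suc n)" for n
  have h0: "0 < h n" for n unfolding h_def by simp
  define D where "D n b x = (if x \<in> S \<and> x + h n *\<^sub>R b \<in> S
      then (real (Suc n))\<^sup>2 * ((V (x + h n *\<^sub>R b) - W (x + h n *\<^sub>R b)) - (V x - W x))\<^sup>2 else 0)" for n b x
  have D0: "0 \<le> D n b x" for n b x unfolding D_def by simp
  define F where "F n b x = ennreal (D n b x)" for n b x
  have [measurable]: "F n b \<in> borel_measurable borel" for n b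
    unfolding F_def[abs_def] D_def by measurable
  define B where "B = measure lborel (ball (0::'a) (R + 1))"
  have "0 \<le> B" unfolding B_def by simp
  define K where "K = E * (8 * L + 4 * C)"
  have K0: "0 \<le> K" unfolding K_def using E0 L0 C by simp
  have int: "(\<integral>\<^sup>+x. F n b x \<partial>lborel) \<le> ennreal (K * B)" if b: "b \<in> Basis" for n b
  proof -
    have sum_le: "(\<Sum>k<Suc n. F n b (x + (real k / real (Suc n)) *\<^sub>R b)) \<le> ennreal (real (Suc n) * K)" for x
    proof -
      define pt where "pt k = x + (real k * h n) *\<^sub>R b" for k
      define P where "P k \<longleftrightarrow> pt k \<in> S" for k
      have Pconv: "P j" if "i \<le> j" "j \<le> k" "P i" "P k" for i j k
        using convex_line_between[OF conv mult_right_mono mult_right_mono, of "real i" "real j" "h n" "real k" x b]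
          that h0[of n] unfolding P_def pt_def by simp
      have c0: "x + (real k / real (Suc n)) *\<^sub>R b = pt k" for k
        unfolding pt_def h_def by simp
      have c1: "pt k + h n *\<^sub>R b = pt (Suc k)" "pt (Suc k) - h n *\<^sub>R b = pt k" for k
        unfolding pt_def by (simp_all add: algebra_simps)
      have lip: "\<bar>f (pt (Suc k)) - f (pt k)\<bar> \<le> L * h n" if "P k" "P (Suc k)" "L-lipschitz_on S f" for k f
      proof -
        have "pt (Suc k) - pt k = h n *\<^sub>R b" using c1(1)[of k] by (simp add: algebra_simps)
        then show ?thesis
          using lipschitz_on_translate_le[OF that(3)] that b h0[of n] unfolding P_def by simp
      qed
      have conc: "f (pt (Suc (Suc k))) - 2 * f (pt (Suc k)) + f (pt k) \<le> C * (h n)\<^sup>2"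
        if "P k" "P (Suc (Suc k))" "concave_on S (\<lambda>x. f x - C / 2 * (norm x)\<^sup>2)" for k f
        using semiconcave_second_diff_le[OF that(3), of "pt (Suc k)" "h n *\<^sub>R b"] that(1,2) b
        unfolding c1 P_def by (simp add: power_mult_distrib)
      have sq: "(\<Sum>k<Suc n. if P k \<and> P (Suc k) then ((v (pt (Suc k)) - w (pt (Suc k))) - (v (pt k) - w (pt k)))\<^sup>2 else 0)
          \<le> E * (8 * (L * h n) + 4 * (C * (h n)\<^sup>2) * real (Suc n))"
      proof (rule sum_squares_diff_le_interval)
        show "P j" if "i \<le> j" "j \<le> k" "P i" "P k" for i j k using that by (rule Pconv)
        show "\<bar>v (pt k) - w (pt k)\<bar> \<le> E" if "P k" for k using E that unfolding P_def by simp
        show "\<bar>v (pt (Suc k)) - v (pt k)\<bar> \<le> L * h n" "\<bar>w (pt (Suc k)) - w (pt k)\<bar> \<le> L * h n"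
          if "P k" "P (Suc k)" for k using that lip vL wL by blast+
        show "v (pt (Suc (Suc k))) - 2 * v (pt (Suc k)) + v (pt k) \<le> C * (h n)\<^sup>2"
          "w (pt (Suc (Suc k))) - 2 * w (pt (Suc k)) + w (pt k) \<le> C * (h n)\<^sup>2"
          if "P k" "P (Suc (Suc k))" for k using that conc v w by blast+
      qed (use L0 C h0[of n] E0 in auto)
      have "(\<Sum>k<Suc n. F n b (x + (real k / real (Suc n)) *\<^sub>R b)) =
          (\<Sum>k<Suc n. ennreal ((real (Suc n))\<^sup>2 *
            (if P k \<and> P (Suc k) then ((v (pt (Suc k)) - w (pt (Suc k))) - (v (pt k) - w (pt k)))\<^sup>2 else 0)))"
        unfolding c0 F_def D_def c1 P_def V_def W_def by (intro sum.cong) auto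
      also have "\<dots> = ennreal ((real (Suc n))\<^sup>2 *
          (\<Sum>k<Suc n. if P k \<and> P (Suc k) then ((v (pt (Suc k)) - w (pt (Suc k))) - (v (pt k) - w (pt k)))\<^sup>2 else 0))"
        unfolding sum_distrib_left by (intro sum_ennreal) auto
      also have "\<dots> \<le> ennreal ((real (Suc n))\<^sup>2 * (E * (8 * (L * h n) + 4 * (C * (h n)\<^sup>2) * real (Suc n))))"
        by (intro ennreal_leI mult_left_mono sq) simp
      also have "(real (Suc n))\<^sup>2 * (E * (8 * (L * h n) + 4 * (C * (h n)\<^sup>2) * real (Suc n))) = real (Suc n) * K"
        unfolding K_def h_def by (simp add: field_simps power2_eq_square del: of_nat_Suc)
      finally show ?thesis .
    qed
    have supp: "norm x < R" if "F n b x \<noteq> 0" for x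
    proof (rule R)
      show "x \<in> S" using that unfolding F_def D_def by (cases "x \<in> S") auto
    qed
    have "(\<integral>\<^sup>+x. F n b x \<partial>lborel) \<le> ennreal (real (Suc n) * K * B / real (Suc n))"
      unfolding B_def
    proof (rule nn_integral_translates_bound[where b = b])
      show "norm x < R" if "F n b x \<noteq> 0" for x using that by (rule supp)
      show "(\<Sum>k<Suc n. F n b (x + (real k / real (Suc n)) *\<^sub>R b)) \<le> ennreal (real (Suc n) * K)" for x by (rule sum_le)
    qed (use b K0 in simp_all)
    then show ?thesis by (simp del: of_nat_Suc)
  qed
  define G where "G n x = (\<Sum>b\<in>Basis. F n b x)" for n x
  have [measurable]: "G n \<in> borel_measurable borel" for n unfolding G_def[abs_def] by measurable
  have "AE x in lborel. (x \<in> S \<longrightarrow> GDERIV v x :> grad v x) \<and> (x \<in> S \<longrightarrow> GDERIV w x :> grad w x)"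
    using semiconcave_lipschitz_gderiv_AE[OF S bS C vL v] semiconcave_lipschitz_gderiv_AE[OF S bS C wL w]
    by (rule eventually_conj)
  then have "AE x in lborel. ennreal (if x \<in> S then (norm (grad v x - grad w x))\<^sup>2 else 0) = liminf (\<lambda>n. G n x)"
  proof (rule eventually_mono)
    fix x assume gd: "(x \<in> S \<longrightarrow> GDERIV v x :> grad v x) \<and> (x \<in> S \<longrightarrow> GDERIV w x :> grad w x)"
    show "ennreal (if x \<in> S then (norm (grad v x - grad w x))\<^sup>2 else 0) = liminf (\<lambda>n. G n x)"
    proof (cases "x \<in> S")
      case False
      then have "G n x = 0" for n unfolding G_def F_def D_def by simp
      then show ?thesis using False by (simp add: Liminf_const)
    next
      case True
      let ?q = "\<lambda>f n b. real (Suc n) * (f (x + (1 / real (Suc n)) *\<^sub>R b) - f x)"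
      have lim: "(\<lambda>n. D n b x) \<longlonglongrightarrow> ((grad v x - grad w x) \<bullet> b)\<^sup>2" for b
      proof (rule Lim_transform_eventually)
        have "(\<lambda>n. (?q v n b - ?q w n b)\<^sup>2) \<longlonglongrightarrow> (grad v x \<bullet> b - grad w x \<bullet> b)\<^sup>2"
          using gd True by (intro tendsto_power tendsto_diff GDERIV_difference_quotient) auto
        then show "(\<lambda>n. (?q v n b - ?q w n b)\<^sup>2) \<longlonglongrightarrow> ((grad v x - grad w x) \<bullet> b)\<^sup>2"
          by (simp add: inner_diff_left)
        show "\<forall>\<^sub>F n in sequentially. (?q v n b - ?q w n b)\<^sup>2 = D n b x"
          using eventually_translate_mem_open[OF S True, of b]
        proof eventually_elim
          case (elim n)
          have "?q v n b - ?q w n b = real (Suc n) *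
              ((v (x + (1 / real (Suc n)) *\<^sub>R b) - w (x + (1 / real (Suc n)) *\<^sub>R b)) - (v x - w x))"
            by (simp add: algebra_simps)
          then show ?case using elim True by (simp add: D_def V_def W_def h_def power_mult_distrib)
        qed
      qed
      have D_lim: "(\<lambda>n. \<Sum>b\<in>Basis. D n b x) \<longlonglongrightarrow> (\<Sum>b\<in>Basis. ((grad v x - grad w x) \<bullet> b)\<^sup>2)"
        by (intro tendsto_sum lim)
      have norm_eq: "(\<Sum>b\<in>Basis. ((grad v x - grad w x) \<bullet> b)\<^sup>2) = (norm (grad v x - grad w x))\<^sup>2"
        unfolding power2_norm_eq_inner euclidean_inner[of "grad v x - grad w x" "grad v x - grad w x"]
        by (simp add: power2_eq_square)
      have G_eq: "G n x = ennreal (\<Sum>b\<in>Basis. D n b x)" for n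
        unfolding G_def F_def using D0 by (intro sum_ennreal) auto
      have "(\<lambda>n. G n x) \<longlonglongrightarrow> ennreal ((norm (grad v x - grad w x))\<^sup>2)"
        unfolding G_eq by (rule tendsto_ennrealI) (rule D_lim[unfolded norm_eq])
      from lim_imp_Liminf[OF _ this] show ?thesis using True by simp
    qed
  qed
  then have "(\<integral>\<^sup>+x. ennreal (if x \<in> S then (norm (grad v x - grad w x))\<^sup>2 else 0) \<partial>lborel)
      = (\<integral>\<^sup>+x. liminf (\<lambda>n. G n x) \<partial>lborel)"
    by (rule nn_integral_cong_AE)
  also have "\<dots> \<le> liminf (\<lambda>n. \<integral>\<^sup>+x. G n x \<partial>lborel)"
    by (rule nn_integral_liminf) measurable
  also have "\<dots> \<le> liminf (\<lambda>n. ennreal (real DIM('a) * K * B))"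
  proof (intro Liminf_mono always_eventually allI)
    fix n
    have "(\<integral>\<^sup>+x. G n x \<partial>lborel) = (\<Sum>b\<in>Basis. \<integral>\<^sup>+x. F n b x \<partial>lborel)"
      unfolding G_def by (rule nn_integral_sum) measurable
    also have "\<dots> \<le> (\<Sum>b\<in>(Basis::'a set). ennreal (K * B))"
      by (intro sum_mono int)
    also have "\<dots> = ennreal (real DIM('a) * K * B)"
      using K0 \<open>0 \<le> B\<close> by (simp add: ennreal_of_nat_eq_real_of_nat ennreal_mult[symmetric] mult.assoc)
    finally show "(\<integral>\<^sup>+x. G n x \<partial>lborel) \<le> ennreal (real DIM('a) * K * B)" .
  qed
  also have "\<dots> = ennreal (real DIM('a) * K * B)" by (simp add: Liminf_const)
  finally show ?thesis unfolding K_def B_def .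
qed

section \<open>Smoothed minima as concave aggregations\<close>

text \<open>
  A Lipschitz function maps the exceptional null set to a null set, so a strict decrease would cross
  some level \<open>c\<close> outside that image; the last crossing of \<open>c\<close> contradicts the sign of the derivative.
\<close>
lemma lipschitz_deriv_nonneg_AE_imp_mono:
  fixes f :: "real \<Rightarrow> real"
  assumes f: "B-lipschitz_on UNIV f"
    and deriv: "AE x in lebesgue. f differentiable at x \<and> 0 \<le> deriv f x" and ab: "a \<le> b"
  shows "f a \<le> f b"
proof (rule ccontr)
  assume "\<not> f a \<le> f b"
  then have lt: "f b < f a" by simp
  with ab have "a < b" by (cases "a = b") auto
  \<comment> \<open>Tilting by half of the mean rate of decrease keeps \<open>F b < F a\<close>,
    while outside the exceptional set the derivative of \<open>F\<close> becomes at least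
    \<open>e\<close> and thus strictly positive.\<close>
  define e where "e = (f a - f b) / (2 * (b - a))"
  have cancel: "p / (2 * q) * q = p / 2" if "q \<noteq> 0" for p q :: real using that by simp
  have e: "0 < e" "e * (b - a) = (f a - f b) / 2"
    unfolding e_def using lt \<open>a < b\<close> by (simp, intro cancel) simp
  define F where "F t = f t + e * t" for t
  have less: "F b < F a" unfolding F_def using e(2) lt by (simp add: algebra_simps)
  have "(B + e * 1)-lipschitz_on UNIV F" unfolding F_def[abs_def]
    using e f by (intro lipschitz_intros) auto
  then have F: "(B + e)-lipschitz_on UNIV F" by simp
  have cont: "continuous_on A F" for A
    using lipschitz_on_continuous_on[OF F] continuous_on_subset by blast
  define N where "N = {x. \<not> (f differentiable at x \<and> 0 \<le> deriv f x)}"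
  have "N \<in> null_sets lebesgue"
    using deriv unfolding N_def completion.AE_iff_null_sets by simp
  then have "negligible N" by (simp add: negligible_iff_null_sets)
  then have "negligible (F ` N)"
  proof (rule negligible_locally_Lipschitz_image[rotated])
    fix x
    show "\<exists>T K. open T \<and> x \<in> T \<and> (\<forall>y\<in>N \<inter> T. norm (F y - F x) \<le> K * norm (y - x))"
      using lipschitz_on_normD[OF F] by (intro exI[of _ UNIV] exI[of _ "B + e"]) auto
  qed simp
  moreover have "\<not> negligible {F b<..<F a}"
    using less unfolding box_real(1)[symmetric] negligible_interval(2) by (simp add: box_real(1))
  ultimately have "\<not> {F b<..<F a} \<subseteq> F ` N" using negligible_subset by blast
  then obtain c where "c \<in> {F b<..<F a}" "c \<notin> F ` N" by blast
  then have c: "F b < c" "c < F a" "c \<notin> F ` N" by auto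
  define A where "A = {t \<in> {a..b}. c \<le> F t}"
  have "closed A" unfolding A_def
    using continuous_closed_preimage[OF cont, of "{a..b}" "{c..}"] by (simp add: vimage_def Int_def)
  moreover have A: "a \<in> A" "bdd_above A" unfolding A_def using \<open>a < b\<close> c by auto
  ultimately have SupA: "Sup A \<in> A" using closed_contains_Sup[of A] by auto
  define x where "x = Sup A"
  have "a \<le> x" "x \<le> b" "c \<le> F x" using SupA unfolding x_def[symmetric] by (auto simp: A_def)
  then have x: "a \<le> x" "x < b" "c \<le> F x" using c(1) by (auto simp: less_le)
  have right: "F t < c" if "x < t" "t \<le> b" for t
  proof (rule ccontr)
    assume "\<not> F t < c"
    then have "t \<in> A" using that x unfolding A_def by auto
    then have "t \<le> x" unfolding x_def using A(2) by (rule cSup_upper)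
    then show False using that by simp
  qed
  have "F x = c"
  proof (rule antisym)
    show "F x \<le> c"
    proof (rule ccontr)
      assume "\<not> F x \<le> c"
      then obtain t where "x \<le> t" "t \<le> b" "F t = c"
        using IVT2'[of F b c x] x c cont by auto
      then show False using right[of t] \<open>\<not> F x \<le> c\<close> by (cases "x = t") auto
    qed
  qed (rule x(3))
  then have "x \<notin> N" using c(3) by blast
  then have fx: "f differentiable at x" "0 \<le> deriv f x" unfolding N_def by auto
  have "DERIV f x :> deriv f x" using fx(1) by (simp add: DERIV_deriv_iff_real_differentiable)
  then have "DERIV F x :> deriv f x + e" unfolding F_def[abs_def]
    by (auto intro!: derivative_eq_intros)
  then obtain d where d: "0 < d" "\<And>h. 0 < h \<Longrightarrow> h < d \<Longrightarrow> F x < F (x + h)"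
    using DERIV_pos_inc_right fx(2) e(1) by (metis add_nonneg_pos)
  define h where "h = min (d / 2) (b - x)"
  have h: "0 < h" "h < d" "x + h \<le> b" unfolding h_def using d(1) x(2) by auto
  show False using d(2)[OF h(1,2)] right[of "x + h"] h \<open>F x = c\<close> by simp
qed

text \<open>Convexity is the delicate item: the second derivative is nonnegative only almost
  everywhere, and it is the Lipschitz continuity of \<open>deriv (g \<epsilon>)\<close> that turns
  this into monotonicity of the first derivative.\<close>

lemma admissible_smoothing_properties:
  assumes g: "admissible_smoothing g" and e: "0 < \<epsilon>"
  shows "mono (g \<epsilon>)" and "x \<le> y \<Longrightarrow> g \<epsilon> y - g \<epsilon> x \<le> y - x" and "convex_on UNIV (g \<epsilon>)"
    and "\<bar>max x 0 - g \<epsilon> x\<bar> \<le> \<epsilon>"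
proof -
  let ?h = "g \<epsilon>"
  have C: "C11 ?h" and d01: "\<And>x. 0 \<le> deriv ?h x" "\<And>x. deriv ?h x \<le> 1"
    and ae: "AE x in lebesgue. deriv ?h differentiable at x \<and> 0 \<le> deriv (deriv ?h) x"
    and err: "\<And>x. \<bar>max x 0 - ?h x\<bar> \<le> \<epsilon>"
    using g e unfolding admissible_smoothing_def by auto
  have D: "DERIV ?h x :> deriv ?h x" for x
    using C unfolding C11_def by (simp add: DERIV_deriv_iff_real_differentiable)
  obtain B where B: "B-lipschitz_on UNIV (deriv ?h)" using C unfolding C11_def by blast
  show "mono ?h"
    by (intro monoI DERIV_nonneg_imp_nondecreasing[of _ _ ?h]) (use D d01 in blast)+
  show "\<bar>max x 0 - ?h x\<bar> \<le> \<epsilon>" by (rule err)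
  show "convex_on UNIV ?h"
    using D lipschitz_deriv_nonneg_AE_imp_mono[OF B ae]
    by (intro convex_on_realI[where f' = "deriv ?h"]) auto
  show "?h y - ?h x \<le> y - x" if "x \<le> y"
  proof -
    have "DERIV (\<lambda>t. t - ?h t) t :> 1 - deriv ?h t" for t
      using D by (auto intro!: derivative_eq_intros)
    then have "x - ?h x \<le> y - ?h y"
      using that d01 by (intro DERIV_nonneg_imp_nondecreasing[of x y "\<lambda>t. t - ?h t"])
        (metis diff_ge_0_iff_ge)+
    then show ?thesis by simp
  qed
qed

text \<open>
  The only structure of the (smoothed) minimum that matters: such functionals do not increase the
  Lipschitz constant, and they commute with the subtraction of a quadratic, hence preserve semiconcavity.
\<close>
definition concave_aggregation :: "nat \<Rightarrow> ((nat \<Rightarrow> real) \<Rightarrow> real) \<Rightarrow> bool" where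
  "concave_aggregation n \<psi> \<longleftrightarrow>
     (\<forall>a b. (\<forall>i\<in>{1..n}. a i \<le> b i) \<longrightarrow> \<psi> a \<le> \<psi> b) \<and>
     (\<forall>a c. \<psi> (\<lambda>i. a i + c) = \<psi> a + c) \<and>
     (\<forall>a b u v. 0 \<le> u \<longrightarrow> 0 \<le> v \<longrightarrow> u + v = 1 \<longrightarrow>
        u * \<psi> a + v * \<psi> b \<le> \<psi> (\<lambda>i. u * a i + v * b i))"

lemma concave_aggregationD:
  assumes "concave_aggregation n \<psi>"
  shows "(\<And>i. i \<in> {1..n} \<Longrightarrow> a i \<le> b i) \<Longrightarrow> \<psi> a \<le> \<psi> b"
    and "\<psi> (\<lambda>i. a i + c) = \<psi> a + c"
    and "0 \<le> u \<Longrightarrow> 0 \<le> v \<Longrightarrow> u + v = 1 \<Longrightarrow> u * \<psi> a + v * \<psi> b \<le> \<psi> (\<lambda>i. u * a i + v * b i)"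
  using assms unfolding concave_aggregation_def by simp_all

lemma concave_aggregation_Min:
  assumes n: "1 \<le> n"
  shows "concave_aggregation n (\<lambda>a. MIN i\<in>{1..n}. a i)"
proof -
  have ne: "{1..n} \<noteq> {}" using n by simp
  have le: "(MIN i\<in>{1..n}. a i) \<le> a i" if "i \<in> {1..n}" for a :: "nat \<Rightarrow> real" and i
    using that by (intro Min_le) auto
  have ge: "c \<le> (MIN i\<in>{1..n}. a i)" if "\<And>i. i \<in> {1..n} \<Longrightarrow> c \<le> a i" for a :: "nat \<Rightarrow> real" and c
    using that ne by (subst Min_ge_iff) auto
  show ?thesis
    unfolding concave_aggregation_def
  proof (intro conjI allI impI)
    fix a b :: "nat \<Rightarrow> real" assume ab: "\<forall>i\<in>{1..n}. a i \<le> b i"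
    show "(MIN i\<in>{1..n}. a i) \<le> (MIN i\<in>{1..n}. b i)"
    proof (rule ge)
      fix i assume i: "i \<in> {1..n}"
      show "(MIN i\<in>{1..n}. a i) \<le> b i" using order_trans[OF le[OF i, of a]] ab i by simp
    qed
  next
    fix a :: "nat \<Rightarrow> real" and c
    show "(MIN i\<in>{1..n}. a i + c) = (MIN i\<in>{1..n}. a i) + c"
      using ne by (intro Min_add_commute) auto
  next
    fix a b :: "nat \<Rightarrow> real" and u v :: real assume uv: "0 \<le> u" "0 \<le> v" "u + v = 1"
    show "u * (MIN i\<in>{1..n}. a i) + v * (MIN i\<in>{1..n}. b i) \<le> (MIN i\<in>{1..n}. u * a i + v * b i)"
    proof (rule ge)
      fix i assume i: "i \<in> {1..n}"
      show "u * (MIN i\<in>{1..n}. a i) + v * (MIN i\<in>{1..n}. b i) \<le> u * a i + v * b i"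
        using le[OF i] uv by (intro add_mono mult_left_mono)
    qed
  qed
qed

text \<open>A nondecreasing \<open>h\<close> gives monotonicity in \<open>b\<close>; a slope of at
  most 1 gives monotonicity in \<open>a\<close>.\<close>

lemma diff_comp_diff_mono:
  fixes h :: "real \<Rightarrow> real"
  assumes h: "mono h" "\<And>x y. x \<le> y \<Longrightarrow> h y - h x \<le> y - x" and le: "a \<le> a'" "b \<le> b'"
  shows "a - h (a - b) \<le> a' - h (a' - b')"
proof -
  have "h (a - b') \<le> h (a - b)" using le(2) by (intro monoD[OF h(1)]) simp
  moreover have "h (a' - b') - h (a - b') \<le> a' - a" using h(2)[of "a - b'" "a' - b'"] le(1) by simp
  ultimately show ?thesis by linarith
qed

text \<open>One step of the recursion depends on the differences between the entry and the previous
  value, so constants pass through. For concavity, convexity of \<open>h\<close> treats the outer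
  function, and monotonicity in the previous value then admits the induction hypothesis.\<close>

lemma concave_aggregation_smooth_min_rec:
  fixes h :: "real \<Rightarrow> real"
  assumes h: "mono h" "\<And>x y. x \<le> y \<Longrightarrow> h y - h x \<le> y - x" "convex_on UNIV h" and n: "1 \<le> n"
  shows "concave_aggregation n (smooth_min_rec h n)"
  unfolding concave_aggregation_def
proof (intro conjI allI impI)
  fix a b :: "nat \<Rightarrow> real" assume "\<forall>i\<in>{1..n}. a i \<le> b i"
  with n show "smooth_min_rec h n a \<le> smooth_min_rec h n b"
  proof (induction n rule: nat_induct_at_least)
    case base
    then show ?case by simp
  next
    case (Suc k)
    then obtain j where j: "k = Suc j" by (cases k) auto
    have "a (Suc k) - h (a (Suc k) - smooth_min_rec h k a) \<le> b (Suc k) - h (b (Suc k) - smooth_min_rec h k b)"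
      by (rule diff_comp_diff_mono[OF h(1,2)]) (use Suc in auto)
    then show ?case unfolding j by simp
  qed
next
  fix a :: "nat \<Rightarrow> real" and c
  show "smooth_min_rec h n (\<lambda>i. a i + c) = smooth_min_rec h n a + c"
    using n by (induction h n a rule: smooth_min_rec.induct) simp_all
next
  fix a b :: "nat \<Rightarrow> real" and u v :: real assume uv: "0 \<le> u" "0 \<le> v" "u + v = 1"
  show "u * smooth_min_rec h n a + v * smooth_min_rec h n b \<le> smooth_min_rec h n (\<lambda>i. u * a i + v * b i)"
    using n
  proof (induction n rule: nat_induct_at_least)
    case base
    then show ?case by simp
  next
    case (Suc k)
    then obtain j where j: "k = Suc j" by (cases k) auto
    let ?s = "smooth_min_rec h k"
    define A B where "A = a (Suc k)" and "B = b (Suc k)"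
    have "h (u * (A - ?s a) + v * (B - ?s b)) \<le> u * h (A - ?s a) + v * h (B - ?s b)"
      using h(3) uv unfolding convex_on_def by simp
    moreover have "u * (A - ?s a) + v * (B - ?s b) = (u * A + v * B) - (u * ?s a + v * ?s b)"
      by (simp add: algebra_simps)
    moreover have "(u * A + v * B) - h ((u * A + v * B) - (u * ?s a + v * ?s b))
        \<le> (u * A + v * B) - h ((u * A + v * B) - ?s (\<lambda>i. u * a i + v * b i))"
      using Suc.IH by (intro diff_comp_diff_mono[OF h(1,2)]) auto
    ultimately have "u * (A - h (A - ?s a)) + v * (B - h (B - ?s b))
        \<le> (u * A + v * B) - h ((u * A + v * B) - ?s (\<lambda>i. u * a i + v * b i))"
      by (simp add: algebra_simps)
    then show ?case unfolding j A_def B_def by simp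
  qed
qed

lemma concave_aggregation_smooth_min:
  assumes "admissible_smoothing g" "1 \<le> n" "0 \<le> \<epsilon>"
  shows "concave_aggregation n (smooth_min g n \<epsilon>)"
proof (cases "\<epsilon> = 0")
  case True
  then show ?thesis using concave_aggregation_Min[OF assms(2)] by (simp add: smooth_min_def[abs_def])
next
  case False
  then have e: "0 < \<epsilon>" using assms by simp
  show ?thesis
    using concave_aggregation_smooth_min_rec[OF admissible_smoothing_properties(1-3)[OF assms(1) e] assms(2)] False
    by (simp add: smooth_min_def[abs_def])
qed

text \<open>Monotonicity together with commutation with constants: \<open>a\<close> lies below
  \<open>b\<close> shifted by \<open>d\<close>, and conversely.\<close>

lemma concave_aggregation_nonexpansive:
  assumes \<psi>: "concave_aggregation n \<psi>" and d: "\<And>i. i \<in> {1..n} \<Longrightarrow> \<bar>a i - b i\<bar> \<le> d"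
  shows "\<bar>\<psi> a - \<psi> b\<bar> \<le> d"
proof -
  have mono: "\<psi> a \<le> \<psi> b + d" if "\<And>i. i \<in> {1..n} \<Longrightarrow> a i \<le> b i + d" for a b
    using concave_aggregationD(1)[OF \<psi>, of a "\<lambda>i. b i + d"] that
    unfolding concave_aggregationD(2)[OF \<psi>] by simp
  have "\<psi> a \<le> \<psi> b + d" "\<psi> b \<le> \<psi> a + d" using d by (intro mono; force)+
  then show ?thesis by linarith
qed

text \<open>Since x - max (x - s) 0 = min x s, each of the \<open>n - 1\<close> recursion steps is
  an exact minimum up to \<epsilon>, and the minimum does not enlarge the error inherited from the
  previous step.\<close>

lemma smooth_min_error:
  assumes g: "admissible_smoothing g" and n: "1 \<le> n" and e: "0 \<le> \<epsilon>"
  shows "\<bar>smooth_min g n \<epsilon> a - (MIN i\<in>{1..n}. a i)\<bar> \<le> (real n - 1) * \<epsilon>"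
proof (cases "\<epsilon> = 0")
  case True
  then show ?thesis by (simp add: smooth_min_def)
next
  case False
  then have e: "0 < \<epsilon>" using e by simp
  have "\<bar>smooth_min_rec (g \<epsilon>) n a - (MIN i\<in>{1..n}. a i)\<bar> \<le> (real n - 1) * \<epsilon>"
    using n
  proof (induction n rule: nat_induct_at_least)
    case base
    then show ?case by simp
  next
    case (Suc k)
    then obtain j where j: "k = Suc j" by (cases k) auto
    let ?s = "smooth_min_rec (g \<epsilon>) k a" and ?m = "MIN i\<in>{1..k}. a i" and ?x = "a (Suc k)"
    have "(MIN i\<in>{1..Suc k}. a i) = min ?x ?m"
      using Suc.hyps by (simp add: atLeastAtMostSuc_conv)
    moreover have "smooth_min_rec (g \<epsilon>) (Suc k) a = ?x - g \<epsilon> (?x - ?s)" unfolding j by simp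
    moreover have "\<bar>max (?x - ?s) 0 - g \<epsilon> (?x - ?s)\<bar> \<le> \<epsilon>"
      by (rule admissible_smoothing_properties(4)[OF g e])
    moreover have "?x - max (?x - ?s) 0 = min ?x ?s" by simp
    moreover have "\<bar>min ?x ?s - min ?x ?m\<bar> \<le> \<bar>?s - ?m\<bar>" by simp
    ultimately have "\<bar>smooth_min_rec (g \<epsilon>) (Suc k) a - (MIN i\<in>{1..Suc k}. a i)\<bar> \<le> \<epsilon> + (real k - 1) * \<epsilon>"
      using Suc.IH by linarith
    then show ?case by (simp add: algebra_simps)
  qed
  then show ?thesis using False by (simp add: smooth_min_def)
qed

text \<open>By u|x|^2 + v|y|^2 - |ux + vy|^2 = uv|x - y|^2 for u + v = 1, the quadratic becomes an
  additive term that does not involve \<open>f\<close>. In this form semiconcavity passes through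
  aggregations, which commute with constants, and through pointwise limits.\<close>

lemma semiconcave_on_iff:
  fixes f :: "'a::real_inner \<Rightarrow> real"
  shows "concave_on S (\<lambda>x. f x - C / 2 * (norm x)\<^sup>2) \<longleftrightarrow> convex S \<and>
    (\<forall>x\<in>S. \<forall>y\<in>S. \<forall>u\<ge>0. \<forall>v\<ge>0. u + v = 1 \<longrightarrow>
      u * f x + v * f y \<le> f (u *\<^sub>R x + v *\<^sub>R y) + C / 2 * (u * v * (norm (x - y))\<^sup>2))"
proof -
  have "(u * (f x - C / 2 * (norm x)\<^sup>2) + v * (f y - C / 2 * (norm y)\<^sup>2)
        \<le> f (u *\<^sub>R x + v *\<^sub>R y) - C / 2 * (norm (u *\<^sub>R x + v *\<^sub>R y))\<^sup>2) \<longleftrightarrow>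
      (u * f x + v * f y \<le> f (u *\<^sub>R x + v *\<^sub>R y) + C / 2 * (u * v * (norm (x - y))\<^sup>2))"
    if uv: "u + v = 1" for x y u v
  proof -
    have v: "v = 1 - u" using uv by simp
    have "u * (norm x)\<^sup>2 + v * (norm y)\<^sup>2 - (norm (u *\<^sub>R x + v *\<^sub>R y))\<^sup>2 = u * v * (norm (x - y))\<^sup>2"
      unfolding v by (simp add: power2_norm_eq_inner inner_add inner_diff inner_commute algebra_simps)
    then have "C / 2 * (u * v * (norm (x - y))\<^sup>2)
        = C / 2 * (u * (norm x)\<^sup>2 + v * (norm y)\<^sup>2 - (norm (u *\<^sub>R x + v *\<^sub>R y))\<^sup>2)" by simp
    then show ?thesis by (intro diff_eq_diff_less_eq) (simp add: algebra_simps)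
  qed
  then show ?thesis unfolding concave_on_iff by auto
qed

lemma semiconcave_aggregation:
  fixes f :: "nat \<Rightarrow> 'a::real_inner \<Rightarrow> real"
  assumes \<psi>: "concave_aggregation n \<psi>" and S: "convex S"
    and f: "\<And>i. i \<in> {1..n} \<Longrightarrow> concave_on S (\<lambda>x. f i x - C / 2 * (norm x)\<^sup>2)"
  shows "concave_on S (\<lambda>x. \<psi> (\<lambda>i. f i x) - C / 2 * (norm x)\<^sup>2)"
  unfolding semiconcave_on_iff
proof (intro conjI ballI allI impI)
  fix x y u v assume h: "x \<in> S" "y \<in> S" "0 \<le> u" "0 \<le> v" "u + v = (1::real)"
  let ?Q = "C / 2 * (u * v * (norm (x - y))\<^sup>2)"
  have "u * \<psi> (\<lambda>i. f i x) + v * \<psi> (\<lambda>i. f i y) \<le> \<psi> (\<lambda>i. u * f i x + v * f i y)"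
    using h by (intro concave_aggregationD(3)[OF \<psi>])
  also have "\<dots> \<le> \<psi> (\<lambda>i. f i (u *\<^sub>R x + v *\<^sub>R y) + ?Q)"
  proof (rule concave_aggregationD(1)[OF \<psi>])
    fix i assume "i \<in> {1..n}"
    from f[OF this, unfolded semiconcave_on_iff] h
    show "u * f i x + v * f i y \<le> f i (u *\<^sub>R x + v *\<^sub>R y) + ?Q" by blast
  qed
  also have "\<dots> = \<psi> (\<lambda>i. f i (u *\<^sub>R x + v *\<^sub>R y)) + ?Q"
    by (rule concave_aggregationD(2)[OF \<psi>])
  finally show "u * \<psi> (\<lambda>i. f i x) + v * \<psi> (\<lambda>i. f i y) \<le> \<psi> (\<lambda>i. f i (u *\<^sub>R x + v *\<^sub>R y)) + ?Q" .
qed (rule S)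

lemma lipschitz_on_aggregation:
  assumes \<psi>: "concave_aggregation n \<psi>" and L: "0 \<le> L" and f: "\<And>i. i \<in> {1..n} \<Longrightarrow> L-lipschitz_on S (f i)"
  shows "L-lipschitz_on S (\<lambda>x. \<psi> (\<lambda>i. f i x))"
proof (rule lipschitz_onI)
  fix x y assume "x \<in> S" "y \<in> S"
  then have "\<bar>f i x - f i y\<bar> \<le> L * dist x y" if "i \<in> {1..n}" for i
    using lipschitz_onD[OF f[OF that]] by (simp add: dist_real_def)
  then show "dist (\<psi> (\<lambda>i. f i x)) (\<psi> (\<lambda>i. f i y)) \<le> L * dist x y"
    unfolding dist_real_def by (rule concave_aggregation_nonexpansive[OF \<psi>])
qed (rule L)

lemma continuous_on_aggregation:
  fixes f :: "nat \<Rightarrow> 'a::metric_space \<Rightarrow> real"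
  assumes \<psi>: "concave_aggregation n \<psi>" and f: "\<And>i. i \<in> {1..n} \<Longrightarrow> continuous_on S (f i)"
  shows "continuous_on S (\<lambda>x. \<psi> (\<lambda>i. f i x))"
  unfolding continuous_on_iff
proof (intro ballI allI impI)
  fix x and e :: real assume x: "x \<in> S" and e: "0 < e"
  have "\<forall>\<^sub>F y in at x within S. \<forall>i\<in>{1..n}. dist (f i y) (f i x) < e / 2"
    using f x e by (intro eventually_ball_finite ballI tendstoD) (auto simp: continuous_on_def)
  then obtain d where d: "0 < d" "\<And>y. y \<in> S \<Longrightarrow> y \<noteq> x \<Longrightarrow> dist y x < d \<Longrightarrow> \<forall>i\<in>{1..n}. dist (f i y) (f i x) < e / 2"
    unfolding eventually_at by blast
  have "dist (\<psi> (\<lambda>i. f i y)) (\<psi> (\<lambda>i. f i x)) < e" if "y \<in> S" "dist y x < d" for y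
  proof (cases "y = x")
    case False
    then have "\<bar>\<psi> (\<lambda>i. f i y) - \<psi> (\<lambda>i. f i x)\<bar> \<le> e / 2"
      using d(2)[OF that(1) False that(2)]
      by (intro concave_aggregation_nonexpansive[OF \<psi>]) (force simp: dist_real_def)
    then show ?thesis using e by (simp add: dist_real_def)
  qed (use e in simp)
  then show "\<exists>d>0. \<forall>x'\<in>S. dist x' x < d \<longrightarrow> dist (\<psi> (\<lambda>i. f i x')) (\<psi> (\<lambda>i. f i x)) < e"
    using d(1) by blast
qed

section \<open>Functions that are twice differentiable up to the boundary\<close>

lemma norm_le_sup_norm:
  assumes "bounded (f ` S)" "x \<in> S"
  shows "norm (f x) \<le> sup_norm S f"
proof -
  have "bdd_above ((\<lambda>x. norm (f x)) ` S)"
    using assms(1) unfolding bounded_iff bdd_above_def by auto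
  then show ?thesis unfolding sup_norm_def using assms(2) by (intro cSup_upper) auto
qed

lemma sup_norm_nonneg:
  assumes "bounded (f ` S)"
  shows "0 \<le> sup_norm S f"
proof -
  have "bdd_above ((\<lambda>x. norm (f x)) ` S)"
    using assms unfolding bounded_iff bdd_above_def by auto
  then show ?thesis unfolding sup_norm_def by (intro cSup_upper) auto
qed

lemma sup_norm_leI:
  assumes "0 \<le> B" "\<And>x. x \<in> S \<Longrightarrow> norm (f x) \<le> B"
  shows "sup_norm S f \<le> B"
  unfolding sup_norm_def using assms by (intro cSup_least) auto

lemma C2_closureD:
  assumes "C2_closure S f"
  shows "continuous_on (closure S) f"
    and "x \<in> S \<Longrightarrow> GDERIV f x :> grad f x"
    and "x \<in> S \<Longrightarrow> (grad f has_derivative blinfun_apply (hess f x)) (at x)"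
  using assms unfolding C2_closure_def by blast+

lemma C2_closure_bounded_derivatives:
  assumes f: "C2_closure S f" and S: "bounded S"
  shows "bounded (grad f ` S)" and "bounded (hess f ` S)"
proof -
  obtain G H where GH: "continuous_on (closure S) G" "continuous_on (closure S) H"
      "\<And>x. x \<in> S \<Longrightarrow> G x = grad f x" "\<And>x. x \<in> S \<Longrightarrow> H x = hess f x"
    using f unfolding C2_closure_def by blast
  have "compact (closure S)" using S by (simp add: compact_closure)
  then have "bounded (G ` closure S)" "bounded (H ` closure S)"
    using GH compact_continuous_image compact_imp_bounded by blast+
  moreover have "grad f ` S \<subseteq> G ` closure S" "hess f ` S \<subseteq> H ` closure S"
    using GH(3,4)[symmetric] closure_subset[of S] by auto
  ultimately show "bounded (grad f ` S)" "bounded (hess f ` S)"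
    by (auto intro: bounded_subset)
qed

lemma C2_closure_lipschitz:
  fixes f :: "'a::euclidean_space \<Rightarrow> real"
  assumes f: "C2_closure S f" and S: "convex S" and L: "0 \<le> L" "\<And>x. x \<in> S \<Longrightarrow> norm (grad f x) \<le> L"
  shows "L-lipschitz_on S f"
proof (rule bounded_derivative_imp_lipschitz[OF _ S _ L(1)])
  fix x assume x: "x \<in> S"
  show "(f has_derivative (\<lambda>h. h \<bullet> grad f x)) (at x within S)"
    using C2_closureD(2)[OF f x] unfolding gderiv_def by (rule has_derivative_at_withinI)
  show "onorm (\<lambda>h. h \<bullet> grad f x) \<le> L"
  proof (rule onorm_le)
    fix h :: 'a
    have "norm (h \<bullet> grad f x) \<le> norm h * norm (grad f x)" by (rule Cauchy_Schwarz_ineq2[folded real_norm_def])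
    also have "\<dots> \<le> norm h * L" using L(2)[OF x] by (intro mult_left_mono) auto
    finally show "norm (h \<bullet> grad f x) \<le> L * norm h" by (simp add: mult.commute)
  qed
qed

lemma C2_closure_semiconcave:
  fixes f :: "'a::euclidean_space \<Rightarrow> real"
  assumes f: "C2_closure S f" and S: "convex S" and C: "\<And>x. x \<in> S \<Longrightarrow> norm (hess f x) \<le> C"
  shows "concave_on S (\<lambda>x. f x - C / 2 * (norm x)\<^sup>2)"
  unfolding semiconcave_on_iff
proof (intro conjI ballI allI impI)
  fix x y u v assume xy: "x \<in> S" "y \<in> S" and uv: "0 \<le> u" "0 \<le> v" "u + v = (1::real)"
  define z where "z = y - x"
  define d where "d = (norm z)\<^sup>2"
  \<comment> \<open>Up to an affine function of \<open>t\<close>, this is the restriction to the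
    segment of the negative of \<open>f\<close> minus the quadratic. Its second derivative is
    nonnegative by Cauchy-Schwarz and the operator norm bound.\<close>
  define q where "q t = C / 2 * t\<^sup>2 * d - f (x + t *\<^sub>R z)" for t
  have mem: "x + t *\<^sub>R z \<in> S" if "t \<in> {0..1}" for t
  proof -
    have "x + t *\<^sub>R z = (1 - t) *\<^sub>R x + t *\<^sub>R y" unfolding z_def by (simp add: algebra_simps)
    then show ?thesis using xy that by (simp add: convexD_alt[OF S])
  qed
  have line: "((\<lambda>t. x + t *\<^sub>R z) has_derivative (\<lambda>s. s *\<^sub>R z)) (at t)" for t
    by (auto intro!: derivative_eq_intros)
  have "convex_on {0..1} q"
  proof (rule f''_ge0_imp_convex[of _ _ "\<lambda>t. C * t * d - z \<bullet> grad f (x + t *\<^sub>R z)"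
        "\<lambda>t. C * d - z \<bullet> blinfun_apply (hess f (x + t *\<^sub>R z)) z"])
    fix t :: real assume t: "t \<in> {0..1}"
    have "((\<lambda>t. f (x + t *\<^sub>R z)) has_derivative (\<lambda>s. (s *\<^sub>R z) \<bullet> grad f (x + t *\<^sub>R z))) (at t)"
      using diff_chain_at[OF line C2_closureD(2)[OF f mem[OF t], unfolded gderiv_def]] by (simp add: o_def)
    then have "DERIV (\<lambda>t. f (x + t *\<^sub>R z)) t :> z \<bullet> grad f (x + t *\<^sub>R z)"
      unfolding has_field_derivative_def by (simp add: mult_commute_abs)
    then show "DERIV q t :> C * t * d - z \<bullet> grad f (x + t *\<^sub>R z)"
      unfolding q_def[abs_def] by (auto intro!: derivative_eq_intros)
    have "((\<lambda>t. grad f (x + t *\<^sub>R z)) has_derivative (\<lambda>s. blinfun_apply (hess f (x + t *\<^sub>R z)) (s *\<^sub>R z))) (at t)"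
      using diff_chain_at[OF line C2_closureD(3)[OF f mem[OF t]]] by (simp add: o_def)
    then have "((\<lambda>t. z \<bullet> grad f (x + t *\<^sub>R z)) has_derivative (\<lambda>s. z \<bullet> blinfun_apply (hess f (x + t *\<^sub>R z)) (s *\<^sub>R z))) (at t)"
      by (rule has_derivative_inner_right)
    then have "DERIV (\<lambda>t. z \<bullet> grad f (x + t *\<^sub>R z)) t :> z \<bullet> blinfun_apply (hess f (x + t *\<^sub>R z)) z"
      unfolding has_field_derivative_def by (simp add: blinfun.scaleR_right mult_commute_abs)
    then show "DERIV (\<lambda>t. C * t * d - z \<bullet> grad f (x + t *\<^sub>R z)) t :> C * d - z \<bullet> blinfun_apply (hess f (x + t *\<^sub>R z)) z"
      by (auto intro!: derivative_eq_intros)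
    have "z \<bullet> blinfun_apply (hess f (x + t *\<^sub>R z)) z \<le> norm z * norm (blinfun_apply (hess f (x + t *\<^sub>R z)) z)"
      by (rule norm_cauchy_schwarz)
    also have "\<dots> \<le> norm z * (norm (hess f (x + t *\<^sub>R z)) * norm z)"
      by (intro mult_left_mono norm_blinfun) simp
    also have "\<dots> \<le> norm z * (C * norm z)"
      using C[OF mem[OF t]] by (intro mult_left_mono mult_right_mono) auto
    finally show "0 \<le> C * d - z \<bullet> blinfun_apply (hess f (x + t *\<^sub>R z)) z"
      unfolding d_def by (simp add: power2_eq_square algebra_simps)
  qed simp
  from convex_onD[OF this uv(2), of 0 1] uv
  have "q v \<le> (1 - v) * q 0 + v * q 1" by simp
  moreover have u: "u = 1 - v" using uv(3) by simp
  moreover have "q v = C / 2 * v\<^sup>2 * d - f (u *\<^sub>R x + v *\<^sub>R y)"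
  proof -
    have "x + v *\<^sub>R z = u *\<^sub>R x + v *\<^sub>R y" unfolding z_def u by (simp add: algebra_simps)
    then show ?thesis unfolding q_def by simp
  qed
  moreover have "(1 - v) * q 0 + v * q 1 = v * (C / 2 * d) - (u * f x + v * f y)"
    unfolding q_def z_def u by (simp add: algebra_simps)
  moreover have "C / 2 * (u * v * (norm (x - y))\<^sup>2) = v * (C / 2 * d) - C / 2 * v\<^sup>2 * d"
    unfolding d_def z_def norm_minus_commute[of y x] u by (simp add: algebra_simps power2_eq_square)
  ultimately show "u * f x + v * f y \<le> f (u *\<^sub>R x + v *\<^sub>R y) + C / 2 * (u * v * (norm (x - y))\<^sup>2)"
    by linarith
qed (rule S)

section \<open>Limits of functions with asymptotic bounds\<close>

lemma lipschitz_on_limit: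
  fixes f :: "nat \<Rightarrow> 'a::metric_space \<Rightarrow> real"
  assumes L: "0 \<le> L" and lim: "\<And>x. x \<in> S \<Longrightarrow> (\<lambda>m. f m x) \<longlonglongrightarrow> F x"
    and f: "\<And>e. 0 < e \<Longrightarrow> \<forall>\<^sub>F m in sequentially. (L + e)-lipschitz_on S (f m)"
  shows "L-lipschitz_on S F"
proof (rule lipschitz_onI)
  fix x y assume xy: "x \<in> S" "y \<in> S"
  \<comment> \<open>The limit in \<open>m\<close> is taken for fixed slack \<open>e\<close>, and
    \<open>e\<close> tends to 0 only afterwards; so the limit function obtains the exact constant
    although no single \<open>f m\<close> need have it.\<close>
  have "dist (F x) (F y) \<le> (L + e) * dist x y" if e: "0 < e" for e
  proof (rule tendsto_upperbound[OF tendsto_dist[OF lim[OF xy(1)] lim[OF xy(2)]]])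
    show "\<forall>\<^sub>F m in sequentially. dist (f m x) (f m y) \<le> (L + e) * dist x y"
      using f[OF e] by eventually_elim (use xy in \<open>auto dest: lipschitz_onD\<close>)
  qed simp
  then show "dist (F x) (F y) \<le> L * dist x y"
  proof -
    assume le: "\<And>e. 0 < e \<Longrightarrow> dist (F x) (F y) \<le> (L + e) * dist x y"
    have "((\<lambda>e. (L + e) * dist x y) \<longlongrightarrow> (L + 0) * dist x y) (at_right 0)"
      by (intro tendsto_intros)
    then show ?thesis
      using tendsto_lowerbound[of "\<lambda>e. (L + e) * dist x y" _ "at_right 0" "dist (F x) (F y)"] le
      by (simp add: eventually_at_right_less eventually_mono[OF eventually_at_right_less])
  qed
qed (rule L)

lemma semiconcave_limit:
  fixes f :: "nat \<Rightarrow> 'a::real_inner \<Rightarrow> real"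
  assumes S: "convex S" and lim: "\<And>x. x \<in> S \<Longrightarrow> (\<lambda>m. f m x) \<longlonglongrightarrow> F x"
    and f: "\<And>e. 0 < e \<Longrightarrow> \<forall>\<^sub>F m in sequentially. concave_on S (\<lambda>x. f m x - (C + e) / 2 * (norm x)\<^sup>2)"
  shows "concave_on S (\<lambda>x. F x - C / 2 * (norm x)\<^sup>2)"
  unfolding semiconcave_on_iff
proof (intro conjI ballI allI impI)
  fix x y u v assume h: "x \<in> S" "y \<in> S" "0 \<le> u" "0 \<le> v" "u + v = (1::real)"
  define Q where "Q = u * v * (norm (x - y))\<^sup>2"
  let ?z = "u *\<^sub>R x + v *\<^sub>R y"
  have z: "?z \<in> S" using S h by (simp add: convexD)
  have le: "u * F x + v * F y - F ?z \<le> (C + e) / 2 * Q" if e: "0 < e" for e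
  proof (rule tendsto_upperbound)
    show "(\<lambda>m. u * f m x + v * f m y - f m ?z) \<longlonglongrightarrow> u * F x + v * F y - F ?z"
      by (intro tendsto_intros lim h z)
    show "\<forall>\<^sub>F m in sequentially. u * f m x + v * f m y - f m ?z \<le> (C + e) / 2 * Q"
      using f[OF e]
    proof eventually_elim
      case (elim m)
      then have "u * f m x + v * f m y \<le> f m ?z + (C + e) / 2 * Q"
        unfolding semiconcave_on_iff Q_def using h by blast
      then show ?case by simp
    qed
  qed simp
  have "((\<lambda>e. (C + e) / 2 * Q) \<longlongrightarrow> (C + 0) / 2 * Q) (at_right 0)"
    by (intro tendsto_intros) simp
  then have "u * F x + v * F y - F ?z \<le> (C + 0) / 2 * Q"
    by (rule tendsto_lowerbound)
      (use le in \<open>auto intro: eventually_mono[OF eventually_at_right_less]\<close>)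
  then show "u * F x + v * F y \<le> F ?z + C / 2 * (u * v * (norm (x - y))\<^sup>2)"
    unfolding Q_def by simp
qed (rule S)

section \<open>Lebesgue norms\<close>

lemma integral_lebesgue_on_le:
  fixes f :: "'a::euclidean_space \<Rightarrow> real"
  assumes S: "S \<in> sets lebesgue" and f: "f \<in> borel_measurable (lebesgue_on S)" "\<And>x. 0 \<le> f x" and J: "0 \<le> J"
    and le: "(\<integral>\<^sup>+x. ennreal (if x \<in> S then f x else 0) \<partial>lborel) \<le> ennreal J"
  shows "(\<integral>x. f x \<partial>lebesgue_on S) \<le> J"
proof -
  have "(\<integral>\<^sup>+x. ennreal (f x) \<partial>lebesgue_on S) = (\<integral>\<^sup>+x. ennreal (f x) * indicator S x \<partial>lebesgue)"
    using S by (intro nn_integral_restrict_space) simp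
  also have "\<dots> = (\<integral>\<^sup>+x. ennreal (f x) * indicator S x \<partial>lborel)"
    by (rule nn_integral_completion)
  also have "\<dots> = (\<integral>\<^sup>+x. ennreal (if x \<in> S then f x else 0) \<partial>lborel)"
    by (intro nn_integral_cong) (simp add: indicator_def)
  finally have "(\<integral>\<^sup>+x. ennreal (f x) \<partial>lebesgue_on S) \<le> ennreal J" using le by simp
  then show ?thesis using f J by (simp add: integral_eq_nn_integral enn2real_leI)
qed

lemma in_Lp_bounded:
  assumes S: "S \<in> lmeasurable" and F: "F \<in> borel_measurable (lebesgue_on S)"
    and A: "AE x in lebesgue_on S. norm (F x) \<le> A" and p: "0 \<le> p"
  shows "in_Lp p S F"
  unfolding in_Lp_def
proof (intro conjI F finite_measure.integrable_const_bound[OF finite_measure_lebesgue_on[OF S]])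
  show "AE x in lebesgue_on S. norm (norm (F x) powr p) \<le> A powr p"
    using A by eventually_elim (use p in \<open>auto intro: powr_mono2\<close>)
  show "(\<lambda>x. norm (F x) powr p) \<in> borel_measurable (lebesgue_on S)" using F by measurable
qed

text \<open>Almost everywhere |F|^p = |F|^(p-2) |F|^2, and the first factor is at most
  A^(p-2).\<close>

lemma Lp_norm_le_of_L2_bounded:
  assumes S: "S \<in> lmeasurable" and F: "F \<in> borel_measurable (lebesgue_on S)"
    and A: "0 \<le> A" "AE x in lebesgue_on S. norm (F x) \<le> A" and p: "2 \<le> p"
    and J: "(\<integral>x. (norm (F x))\<^sup>2 \<partial>lebesgue_on S) \<le> J"
  shows "Lp_norm p S F \<le> (A powr (p - 2) * J) powr (1 / p)"
proof -
  have int: "integrable (lebesgue_on S) (\<lambda>x. norm (F x) powr q)" if "0 \<le> q" for q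
    using in_Lp_bounded[OF S F A(2) that] unfolding in_Lp_def by blast
  have sq: "norm (F x) powr 2 = (norm (F x))\<^sup>2" for x by (simp add: powr_numeral)
  have "(\<integral>x. norm (F x) powr p \<partial>lebesgue_on S) \<le> (\<integral>x. A powr (p - 2) * (norm (F x))\<^sup>2 \<partial>lebesgue_on S)"
  proof (rule integral_mono_AE)
    show "AE x in lebesgue_on S. norm (F x) powr p \<le> A powr (p - 2) * (norm (F x))\<^sup>2"
      using A(2)
    proof eventually_elim
      case (elim x)
      have "norm (F x) powr p = norm (F x) powr (p - 2) * norm (F x) powr 2"
        using powr_add[of "norm (F x)" "p - 2" 2] by simp
      also have "\<dots> \<le> A powr (p - 2) * norm (F x) powr 2"
        using elim p by (intro mult_right_mono powr_mono2) auto
      finally show ?case unfolding sq .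
    qed
  qed (use int[of p] int[of 2] p sq in auto)
  also have "\<dots> \<le> A powr (p - 2) * J" using J by (simp add: mult_left_mono)
  finally show ?thesis
    unfolding Lp_norm_def using p by (intro powr_mono2) auto
qed

text \<open>
  Hoelder's inequality with exponents \<open>2/p\<close> and \<open>2/(2-p)\<close>: Young's inequality
  \<open>(t\<^sup>2)\<^bsup>p/2\<^esup> s\<^bsup>1-p/2\<^esup> \<le> p/2 t\<^sup>2 + (1-p/2) s\<close> is integrated with \<open>s = J / |S|\<close>.
\<close>
lemma Lp_norm_le_of_L2:
  assumes S: "S \<in> lmeasurable" and F: "F \<in> borel_measurable (lebesgue_on S)"
    and A: "AE x in lebesgue_on S. norm (F x) \<le> A" and p: "1 \<le> p" "p < 2"
    and J: "(\<integral>x. (norm (F x))\<^sup>2 \<partial>lebesgue_on S) \<le> J"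
  shows "Lp_norm p S F \<le> measure lebesgue S powr ((2 - p) / (2 * p)) * J powr (1 / 2)"
proof -
  let ?M = "lebesgue_on S" and ?m = "measure lebesgue S"
  let ?I = "\<integral>x. norm (F x) powr p \<partial>?M"
  have int: "integrable ?M (\<lambda>x. norm (F x) powr q)" if "0 \<le> q" for q
    using in_Lp_bounded[OF S F A that] unfolding in_Lp_def by blast
  have "norm (F x) powr 2 = (norm (F x))\<^sup>2" for x by (simp add: powr_numeral)
  then have int2: "integrable ?M (\<lambda>x. (norm (F x))\<^sup>2)" using int[of 2] by simp
  have I0: "0 \<le> ?I" and J0: "0 \<le> (\<integral>x. (norm (F x))\<^sup>2 \<partial>?M)" by simp_all
  \<comment> \<open>The choice \<open>s = J / ?m\<close> requires both quantities to be positive; in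
    either degenerate case \<open>F\<close> vanishes almost everywhere.\<close>
  have zero: ?thesis if "AE x in ?M. F x = 0"
  proof -
    have "?I = 0"
      by (rule integral_eq_zero_AE) (use that in eventually_elim, simp)
    then show ?thesis unfolding Lp_norm_def by simp
  qed
  show ?thesis
  proof (cases "?m = 0")
    case True
    then have "emeasure lebesgue S = 0" using S by (simp add: emeasure_eq_measure2)
    then have "AE x in lebesgue. x \<notin> S" using S by (intro AE_not_in) auto
    then have "AE x in ?M. F x = 0" using S by (subst AE_restrict_space_iff) (auto elim: eventually_mono)
    then show ?thesis by (rule zero)
  next
    case m: False
    show ?thesis
    proof (cases "J = 0")
      case True
      then have "(\<integral>x. (norm (F x))\<^sup>2 \<partial>?M) = 0" using J J0 by simp
      then have "AE x in ?M. (norm (F x))\<^sup>2 = 0"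
        using integral_nonneg_eq_0_iff_AE[OF int2] by simp
      then show ?thesis by (intro zero) (auto elim: eventually_mono)
    next
      case False
      then have J1: "0 < J" using J J0 by linarith
      have m1: "0 < ?m" using m by (simp add: zero_less_measure_iff)
      define s where "s = J / ?m"
      have s: "0 < s" unfolding s_def using J1 m1 by simp
      have young: "norm (F x) powr p * s powr (1 - p / 2) \<le> p / 2 * (norm (F x))\<^sup>2 + (1 - p / 2) * s" for x
      proof (cases "F x = 0")
        case False
        have "((norm (F x))\<^sup>2) powr (p / 2) * s powr (1 - p / 2) \<le> p / 2 * (norm (F x))\<^sup>2 + (1 - p / 2) * s"
          using p s False by (intro Youngs_inequality_0) auto
        moreover have "((norm (F x))\<^sup>2) powr (p / 2) = norm (F x) powr p"
          using False by (simp add: powr_powr flip: powr_numeral)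
        ultimately show ?thesis by simp
      qed (use s p in simp)
      have fin: "finite_measure ?M" using S by (rule finite_measure_lebesgue_on)
      have "?I * s powr (1 - p / 2) = (\<integral>x. norm (F x) powr p * s powr (1 - p / 2) \<partial>?M)" by simp
      also have "\<dots> \<le> (\<integral>x. p / 2 * (norm (F x))\<^sup>2 + (1 - p / 2) * s \<partial>?M)"
        using young int[of p] int2 p finite_measure.integrable_const[OF fin]
        by (intro integral_mono integrable_mult_left Bochner_Integration.integrable_add integrable_mult_right) auto
      also have "\<dots> = p / 2 * (\<integral>x. (norm (F x))\<^sup>2 \<partial>?M) + (1 - p / 2) * s * ?m"
        using int2 finite_measure.integrable_const[OF fin] S
        by (subst Bochner_Integration.integral_add) (auto simp: measure_restrict_space)
      also have "\<dots> \<le> p / 2 * J + (1 - p / 2) * s * ?m"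
        using J p by (intro add_right_mono mult_left_mono) auto
      also have "\<dots> = J" unfolding s_def using m1 by (simp add: field_simps)
      finally have "?I \<le> J / s powr (1 - p / 2)" using s by (simp add: pos_le_divide_eq)
      also have "\<dots> = J powr (p / 2) * ?m powr (1 - p / 2)"
      proof -
        have "J = J powr (p / 2) * J powr (1 - p / 2)" using powr_add[of J "p / 2" "1 - p / 2"] J1 by simp
        moreover have "s powr (1 - p / 2) = J powr (1 - p / 2) / ?m powr (1 - p / 2)"
          unfolding s_def using J1 m1 by (simp add: powr_divide)
        moreover have "a * b / (b / c) = a * c" if "b \<noteq> 0" for a b c :: real using that by simp
        ultimately show ?thesis using J1 by (metis less_irrefl powr_gt_zero)
      qed
      finally have "?I powr (1 / p) \<le> (J powr (p / 2) * ?m powr (1 - p / 2)) powr (1 / p)"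
        using I0 p by (intro powr_mono2) auto
      also have "\<dots> = J powr (1 / 2) * ?m powr ((2 - p) / (2 * p))"
        using p J1 m1 by (simp add: powr_mult powr_powr field_simps)
      finally show ?thesis unfolding Lp_norm_def by (simp add: mult.commute)
    qed
  qed
qed

section \<open>Gradient estimates in Lebesgue norms\<close>

lemma AE_lebesgue_on_of_lborel:
  assumes "S \<in> sets lebesgue" "AE x in lborel. x \<in> S \<longrightarrow> P x"
  shows "AE x in lebesgue_on S. P x"
  using assms by (simp add: AE_restrict_space_iff AE_completion)

text \<open>\<open>J\<close> may be any majorant of the explicit L2 constant, so the final estimate
  can insert an expression of the required shape. For p \<ge> 2 the other ingredient is that two
  gradients of norm at most \<open>L\<close> differ by at most \<open>2 * L\<close>.\<close>

lemma semiconcave_gradient_Lp_estimates: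
  fixes v w :: "'a::euclidean_space \<Rightarrow> real"
  assumes S: "open S" and R: "\<And>x. x \<in> S \<Longrightarrow> norm x < R" and C: "0 \<le> C" and E0: "0 \<le> E"
    and v: "L-lipschitz_on S v" "concave_on S (\<lambda>x. v x - C / 2 * (norm x)\<^sup>2)"
    and w: "L-lipschitz_on S w" "concave_on S (\<lambda>x. w x - C / 2 * (norm x)\<^sup>2)"
    and E: "\<And>x. x \<in> S \<Longrightarrow> \<bar>v x - w x\<bar> \<le> E"
    and J: "real DIM('a) * (E * (8 * L + 4 * C)) * measure lborel (ball (0::'a) (R + 1)) \<le> J"
  defines "F \<equiv> \<lambda>x. grad w x - grad v x"
  shows "1 \<le> p \<Longrightarrow> in_Lp p S F"
    and "2 \<le> p \<Longrightarrow> Lp_norm p S F \<le> ((2 * L) powr (p - 2) * J) powr (1 / p)"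
    and "1 \<le> p \<Longrightarrow> p < 2 \<Longrightarrow> Lp_norm p S F \<le> measure lebesgue S powr ((2 - p) / (2 * p)) * J powr (1 / 2)"
proof -
  have L0: "0 \<le> L" using v(1) by (rule lipschitz_on_nonneg)
  have bS: "bounded S" using R unfolding bounded_iff by (meson less_imp_le)
  have Sm: "S \<in> lmeasurable" using bS S by (rule lmeasurable_open)
  have meas: "F \<in> borel_measurable (lebesgue_on S)"
    unfolding F_def using semiconcave_lipschitz_grad_measurable[OF S bS C] v w
    by (intro borel_measurable_diff) auto
  have "AE x in lborel. x \<in> S \<longrightarrow> norm (F x) \<le> 2 * L"
    using semiconcave_lipschitz_gderiv_AE[OF S bS C v] semiconcave_lipschitz_gderiv_AE[OF S bS C w]
  proof eventually_elim
    case (elim x)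
    show ?case
    proof
      assume x: "x \<in> S"
      have "norm (grad v x) \<le> L" "norm (grad w x) \<le> L"
        using GDERIV_lipschitz_norm_le[OF S x] v(1) w(1) elim x by blast+
      then show "norm (F x) \<le> 2 * L" unfolding F_def using norm_triangle_ineq4[of "grad w x" "grad v x"] by linarith
    qed
  qed
  then have bound: "AE x in lebesgue_on S. norm (F x) \<le> 2 * L"
    using Sm by (intro AE_lebesgue_on_of_lborel) auto
  have J0: "0 \<le> J" using J E0 L0 C by (auto intro: order_trans[rotated])
  have norm_F: "norm (F x) = norm (grad v x - grad w x)" for x
    unfolding F_def by (rule norm_minus_commute)
  have "(\<integral>\<^sup>+x. ennreal (if x \<in> S then (norm (F x))\<^sup>2 else 0) \<partial>lborel) \<le> ennreal J"
    unfolding norm_F by (rule order_trans[OF semiconcave_gradient_L2_estimate[OF S R C E0 v w E] ennreal_leI[OF J]])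
  then have int: "(\<integral>x. (norm (F x))\<^sup>2 \<partial>lebesgue_on S) \<le> J"
    using Sm meas J0 by (intro integral_lebesgue_on_le) auto
  show "in_Lp p S F" if "1 \<le> p" using in_Lp_bounded[OF Sm meas bound] that by simp
  show "Lp_norm p S F \<le> ((2 * L) powr (p - 2) * J) powr (1 / p)" if "2 \<le> p"
    using Lp_norm_le_of_L2_bounded[OF Sm meas _ bound that int] L0 by simp
  show "Lp_norm p S F \<le> measure lebesgue S powr ((2 - p) / (2 * p)) * J powr (1 / 2)" if "1 \<le> p" "p < 2"
    by (rule Lp_norm_le_of_L2[OF Sm meas bound that int])
qed

section \<open>The estimates for the minimum and its approximations\<close>

lemma semiconcave_on_mono:
  fixes f :: "'a::real_inner \<Rightarrow> real"
  assumes f: "concave_on S (\<lambda>x. f x - C / 2 * (norm x)\<^sup>2)" and le: "C \<le> D"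
  shows "concave_on S (\<lambda>x. f x - D / 2 * (norm x)\<^sup>2)"
  unfolding semiconcave_on_iff
proof (intro conjI ballI allI impI)
  show "convex S" using f by (rule concave_on_imp_convex)
  fix x y u v assume h: "x \<in> S" "y \<in> S" "0 \<le> u" "0 \<le> v" "u + v = (1::real)"
  have "C / 2 * (u * v * (norm (x - y))\<^sup>2) \<le> D / 2 * (u * v * (norm (x - y))\<^sup>2)"
    using le h by (intro mult_right_mono) auto
  moreover have "u * f x + v * f y \<le> f (u *\<^sub>R x + v *\<^sub>R y) + C / 2 * (u * v * (norm (x - y))\<^sup>2)"
    using f[unfolded semiconcave_on_iff] h by blast
  ultimately show "u * f x + v * f y \<le> f (u *\<^sub>R x + v *\<^sub>R y) + D / 2 * (u * v * (norm (x - y))\<^sup>2)"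
    by linarith
qed

lemma eventually_less_of_limsup_le:
  assumes "limsup (\<lambda>m. ereal (a m)) \<le> ereal L" "L < K"
  shows "\<forall>\<^sub>F m in sequentially. a m < K"
proof -
  have "limsup (\<lambda>m. ereal (a m)) < ereal K" using assms by (simp add: order_le_less_trans)
  from Limsup_lessD[OF this] show ?thesis by simp
qed

text \<open>\<open>K\<close> is chosen before all other data, so it depends on \<Omega> and
  \<open>p\<close> alone, and it is constant for p in [1,2]. \<open>grad\<close> and the integral
  have default values where a derivative or integrability is missing; the differentiability and
  \<open>in_Lp\<close> clauses give the norm inequalities their intended meaning.\<close>

theorem theorem4p1:
  fixes \<Omega> :: "'a::euclidean_space set"
  assumes "open \<Omega>" and "bounded \<Omega>" and "convex \<Omega>"
  shows "\<exists>K :: real \<Rightarrow> real. (\<forall>p. 0 < K p) \<and> (\<forall>p\<in>{1..2}. K p = K 2) \<and>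
    (\<forall>(n::nat) (g :: real \<Rightarrow> real \<Rightarrow> real) (\<phi> :: nat \<Rightarrow> 'a \<Rightarrow> real)
       (\<phi>' :: nat \<Rightarrow> nat \<Rightarrow> 'a \<Rightarrow> real) (L::real) (C::real).
       1 \<le> n \<longrightarrow>
       admissible_smoothing g \<longrightarrow>
       (\<forall>i\<in>{1..n}. continuous_on (closure \<Omega>) (\<phi> i)) \<longrightarrow>
       (\<forall>i\<in>{1..n}. \<forall>m\<ge>1. C2_closure \<Omega> (\<phi>' i m)) \<longrightarrow>
       (\<forall>i\<in>{1..n}. uniform_limit (closure \<Omega>) (\<phi>' i) (\<phi> i) sequentially) \<longrightarrow>
       0 < L \<longrightarrow> 0 < C \<longrightarrow>
       limsup (\<lambda>m. ereal (grad_bound \<Omega> n \<phi>' m)) \<le> ereal L \<longrightarrow>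
       limsup (\<lambda>m. ereal (hess_bound \<Omega> n \<phi>' m)) \<le> ereal C \<longrightarrow>
         (\<forall>m\<ge>1. \<forall>\<epsilon>\<ge>0.
            sup_norm (closure \<Omega>) (\<lambda>x. v_min n \<phi> x - v_approx g n \<phi>' m \<epsilon> x) \<le> err \<Omega> n \<phi> \<phi>' m \<epsilon>) \<and>
         (AE x in lebesgue_on \<Omega>. v_min n \<phi> differentiable at x) \<and>
         (\<forall>m\<ge>1. \<forall>\<epsilon>\<ge>0. AE x in lebesgue_on \<Omega>. v_approx g n \<phi>' m \<epsilon> differentiable at x) \<and>
         (\<forall>m\<ge>1. \<forall>\<epsilon>\<ge>0. \<forall>p\<ge>1.
            in_Lp p \<Omega> (\<lambda>x. grad (v_approx g n \<phi>' m \<epsilon>) x - grad (v_min n \<phi>) x)) \<and>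
         (\<exists>M. \<forall>m\<ge>1. m \<ge> M \<or> (grad_bound \<Omega> n \<phi>' m \<le> L \<and> hess_bound \<Omega> n \<phi>' m \<le> C) \<longrightarrow>
            (\<forall>\<epsilon>\<ge>0. \<forall>p.
              (2 \<le> p \<longrightarrow>
                 Lp_norm p \<Omega> (\<lambda>x. grad (v_approx g n \<phi>' m \<epsilon>) x - grad (v_min n \<phi>) x)
                 \<le> L powr ((p - 2) / p) *
                   (K p * err \<Omega> n \<phi> \<phi>' m \<epsilon> * (C + L + err \<Omega> n \<phi> \<phi>' m \<epsilon>)) powr (1 / p)) \<and>
              (1 \<le> p \<and> p < 2 \<longrightarrow>
                 Lp_norm p \<Omega> (\<lambda>x. grad (v_approx g n \<phi>' m \<epsilon>) x - grad (v_min n \<phi>) x)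
                 \<le> measure lebesgue \<Omega> powr ((2 - p) / (2 * p)) *
                   (K p * err \<Omega> n \<phi> \<phi>' m \<epsilon> * (C + L + err \<Omega> n \<phi> \<phi>' m \<epsilon>)) powr (1 / 2)))) \<and>
         semiconcave C \<Omega> (v_min n \<phi>) \<and>
         L-lipschitz_on (closure \<Omega>) (v_min n \<phi>))"
proof -
  obtain R where R: "\<And>x. x \<in> \<Omega> \<Longrightarrow> norm x < R" using bounded_pos_less[THEN iffD1, OF assms(2)] by blast
  have \<Omega>leb: "\<Omega> \<in> sets lebesgue" using assms(1) by (simp add: sets_completionI_sets)
  define B where "B = measure lborel (ball (0::'a) (R + 1))"
  have B0: "0 \<le> B" unfolding B_def by simp
  \<comment> \<open>With the doubled bounds, 8(2L) + 4(2C) \<le> 16(C + L + E) gives the factor 16;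
    adding 1 makes \<open>K\<^sub>0\<close> strictly positive even if \<open>B\<close> is 0.\<close>
  define K\<^sub>0 where "K\<^sub>0 = 16 * real DIM('a) * B + 1"
  have K\<^sub>0: "0 < K\<^sub>0" unfolding K\<^sub>0_def using B0 by (simp add: add_nonneg_pos)
  \<comment> \<open>The power of 4 splits (4L)^(p-2) into the factor L^(p-2) of the claim and a
    remainder; the maximum with 0 makes \<open>K\<close> equal to \<open>K\<^sub>0\<close> up to p =
    2.\<close>
  define K :: "real \<Rightarrow> real" where "K p = K\<^sub>0 * 4 powr (max 0 (p - 2))" for p
  show ?thesis
  proof (rule exI[of _ K], intro conjI)
    show "\<forall>p. 0 < K p" unfolding K_def using K\<^sub>0 by simp
    show "\<forall>p\<in>{1..2}. K p = K 2" unfolding K_def by simp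
  next
    show "(\<forall>(n::nat) (g :: real \<Rightarrow> real \<Rightarrow> real) (\<phi> :: nat \<Rightarrow> 'a \<Rightarrow> real)
       (\<phi>' :: nat \<Rightarrow> nat \<Rightarrow> 'a \<Rightarrow> real) (L::real) (C::real).
       1 \<le> n \<longrightarrow>
       admissible_smoothing g \<longrightarrow>
       (\<forall>i\<in>{1..n}. continuous_on (closure \<Omega>) (\<phi> i)) \<longrightarrow>
       (\<forall>i\<in>{1..n}. \<forall>m\<ge>1. C2_closure \<Omega> (\<phi>' i m)) \<longrightarrow>
       (\<forall>i\<in>{1..n}. uniform_limit (closure \<Omega>) (\<phi>' i) (\<phi> i) sequentially) \<longrightarrow>
       0 < L \<longrightarrow> 0 < C \<longrightarrow>
       limsup (\<lambda>m. ereal (grad_bound \<Omega> n \<phi>' m)) \<le> ereal L \<longrightarrow>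
       limsup (\<lambda>m. ereal (hess_bound \<Omega> n \<phi>' m)) \<le> ereal C \<longrightarrow>
         (\<forall>m\<ge>1. \<forall>\<epsilon>\<ge>0.
            sup_norm (closure \<Omega>) (\<lambda>x. v_min n \<phi> x - v_approx g n \<phi>' m \<epsilon> x) \<le> err \<Omega> n \<phi> \<phi>' m \<epsilon>) \<and>
         (AE x in lebesgue_on \<Omega>. v_min n \<phi> differentiable at x) \<and>
         (\<forall>m\<ge>1. \<forall>\<epsilon>\<ge>0. AE x in lebesgue_on \<Omega>. v_approx g n \<phi>' m \<epsilon> differentiable at x) \<and>
         (\<forall>m\<ge>1. \<forall>\<epsilon>\<ge>0. \<forall>p\<ge>1.
            in_Lp p \<Omega> (\<lambda>x. grad (v_approx g n \<phi>' m \<epsilon>) x - grad (v_min n \<phi>) x)) \<and>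
         (\<exists>M. \<forall>m\<ge>1. m \<ge> M \<or> (grad_bound \<Omega> n \<phi>' m \<le> L \<and> hess_bound \<Omega> n \<phi>' m \<le> C) \<longrightarrow>
            (\<forall>\<epsilon>\<ge>0. \<forall>p.
              (2 \<le> p \<longrightarrow>
                 Lp_norm p \<Omega> (\<lambda>x. grad (v_approx g n \<phi>' m \<epsilon>) x - grad (v_min n \<phi>) x)
                 \<le> L powr ((p - 2) / p) *
                   (K p * err \<Omega> n \<phi> \<phi>' m \<epsilon> * (C + L + err \<Omega> n \<phi> \<phi>' m \<epsilon>)) powr (1 / p)) \<and>
              (1 \<le> p \<and> p < 2 \<longrightarrow>
                 Lp_norm p \<Omega> (\<lambda>x. grad (v_approx g n \<phi>' m \<epsilon>) x - grad (v_min n \<phi>) x)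
                 \<le> measure lebesgue \<Omega> powr ((2 - p) / (2 * p)) *
                   (K p * err \<Omega> n \<phi> \<phi>' m \<epsilon> * (C + L + err \<Omega> n \<phi> \<phi>' m \<epsilon>)) powr (1 / 2)))) \<and>
         semiconcave C \<Omega> (v_min n \<phi>) \<and>
         L-lipschitz_on (closure \<Omega>) (v_min n \<phi>))"
    proof (intro allI impI, goal_cases)
      case (1 n g \<phi> \<phi>' L C)
      note n = 1(1) and g = 1(2)
      have \<phi>_cont: "continuous_on (closure \<Omega>) (\<phi> i)" if "i \<in> {1..n}" for i using 1(3) that by blast
      have C2: "C2_closure \<Omega> (\<phi>' i m)" if "i \<in> {1..n}" "1 \<le> m" for i m using 1(4) that by blast
      have unif: "uniform_limit (closure \<Omega>) (\<phi>' i) (\<phi> i) sequentially" if "i \<in> {1..n}" for i using 1(5) that by blast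
      have L: "0 < L" and C: "0 < C" using 1(6,7) .
      note gb_lim = eventually_less_of_limsup_le[OF 1(8)] and hb_lim = eventually_less_of_limsup_le[OF 1(9)]
      let ?gb = "grad_bound \<Omega> n \<phi>'" and ?hb = "hess_bound \<Omega> n \<phi>'"
      have ne: "{1..n} \<noteq> {}" using n by simp
      have grad_le: "norm (grad (\<phi>' i m) x) \<le> ?gb m" if "i \<in> {1..n}" "1 \<le> m" "x \<in> \<Omega>" for i m x
      proof -
        have "norm (grad (\<phi>' i m) x) \<le> sup_norm \<Omega> (grad (\<phi>' i m))"
          using C2_closure_bounded_derivatives[OF C2 assms(2)] that by (intro norm_le_sup_norm) auto
        also have "\<dots> \<le> ?gb m" unfolding grad_bound_def using that by (intro Max_ge) auto
        finally show ?thesis .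
      qed
      have hess_le: "norm (hess (\<phi>' i m) x) \<le> ?hb m" if "i \<in> {1..n}" "1 \<le> m" "x \<in> \<Omega>" for i m x
      proof -
        have "norm (hess (\<phi>' i m) x) \<le> sup_norm \<Omega> (hess (\<phi>' i m))"
          using C2_closure_bounded_derivatives[OF C2 assms(2)] that by (intro norm_le_sup_norm) auto
        also have "\<dots> \<le> ?hb m" unfolding hess_bound_def using that by (intro Max_ge) auto
        finally show ?thesis .
      qed
      have lip': "l-lipschitz_on \<Omega> (\<phi>' i m)" if "i \<in> {1..n}" "1 \<le> m" "?gb m \<le> l" "0 \<le> l" for i m l
        using grad_le[OF that(1,2)] that by (intro C2_closure_lipschitz C2 assms) (auto intro: order_trans)
      have sc': "concave_on \<Omega> (\<lambda>x. \<phi>' i m x - c / 2 * (norm x)\<^sup>2)" if "i \<in> {1..n}" "1 \<le> m" "?hb m \<le> c" for i m c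
        using hess_le[OF that(1,2)] that by (intro C2_closure_semiconcave C2 assms) (auto intro: order_trans)
      have ptw: "(\<lambda>m. \<phi>' i m x) \<longlonglongrightarrow> \<phi> i x" if "i \<in> {1..n}" "x \<in> \<Omega>" for i x
        using tendsto_uniform_limitI[OF unif[OF that(1)]] that(2) closure_subset by blast
      have lip: "L-lipschitz_on \<Omega> (\<phi> i)" if i: "i \<in> {1..n}" for i
      proof (rule lipschitz_on_limit[where f = "\<phi>' i"])
        fix e :: real assume e: "0 < e"
        then have "\<forall>\<^sub>F m in sequentially. ?gb m < L + e" by (intro gb_lim) simp
        then show "\<forall>\<^sub>F m in sequentially. (L + e)-lipschitz_on \<Omega> (\<phi>' i m)"
          using eventually_ge_at_top[of 1] by eventually_elim (use e L in \<open>auto intro!: lip'[OF i]\<close>)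
      qed (use L ptw i in auto)
      have sc: "concave_on \<Omega> (\<lambda>x. \<phi> i x - C / 2 * (norm x)\<^sup>2)" if i: "i \<in> {1..n}" for i
      proof (rule semiconcave_limit[where f = "\<phi>' i"])
        fix e :: real assume "0 < e"
        then have "\<forall>\<^sub>F m in sequentially. ?hb m < C + e" by (intro hb_lim) simp
        then show "\<forall>\<^sub>F m in sequentially. concave_on \<Omega> (\<lambda>x. \<phi>' i m x - (C + e) / 2 * (norm x)\<^sup>2)"
          using eventually_ge_at_top[of 1] by eventually_elim (rule sc'[OF i]; simp)
      qed (use assms ptw i in auto)
      let ?v = "v_min n \<phi>" and ?w = "v_approx g n \<phi>'" and ?E = "err \<Omega> n \<phi> \<phi>'"
      \<comment> \<open>The exact minimum is the aggregation with parameter 0, so the same lemmas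
        serve \<open>?v\<close> and the approximations.\<close>
      have v_eq: "?v = (\<lambda>x. smooth_min g n 0 (\<lambda>i. \<phi> i x))"
        by (simp add: v_min_def[abs_def] smooth_min_def)
      have w_eq: "?w m \<epsilon> = (\<lambda>x. smooth_min g n \<epsilon> (\<lambda>i. \<phi>' i m x))" for m \<epsilon>
        by (simp add: v_approx_def[abs_def])
      note agg = concave_aggregation_smooth_min[OF g n]
      have v_lip: "l-lipschitz_on \<Omega> ?v" if "L \<le> l" for l
        unfolding v_eq using L that lip by (intro lipschitz_on_aggregation[OF agg]) (auto intro: lipschitz_on_le)
      have v_sc: "concave_on \<Omega> (\<lambda>x. ?v x - c / 2 * (norm x)\<^sup>2)" if "C \<le> c" for c
      proof (rule semiconcave_on_mono[OF _ that])
        show "concave_on \<Omega> (\<lambda>x. ?v x - C / 2 * (norm x)\<^sup>2)"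
          unfolding v_eq using sc assms by (intro semiconcave_aggregation[OF agg]) auto
      qed
      have v_cont: "continuous_on (closure \<Omega>) ?v"
        unfolding v_eq using \<phi>_cont by (intro continuous_on_aggregation[OF agg]) auto
      have w_lip: "l-lipschitz_on \<Omega> (?w m \<epsilon>)" if "1 \<le> m" "0 \<le> \<epsilon>" "?gb m \<le> l" "0 \<le> l" for m \<epsilon> l
        unfolding w_eq using that lip' by (intro lipschitz_on_aggregation[OF agg]) auto
      have w_sc: "concave_on \<Omega> (\<lambda>x. ?w m \<epsilon> x - c / 2 * (norm x)\<^sup>2)" if "1 \<le> m" "0 \<le> \<epsilon>" "?hb m \<le> c" for m \<epsilon> c
        unfolding w_eq using that sc' assms by (intro semiconcave_aggregation[OF agg]) auto
      have bdd: "bounded ((\<lambda>x. \<phi> i x - \<phi>' i m x) ` closure \<Omega>)" if "i \<in> {1..n}" "1 \<le> m" for i m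
        using \<phi>_cont[OF that(1)] C2_closureD(1)[OF C2[OF that]] assms(2)
        by (intro compact_imp_bounded compact_continuous_image continuous_on_diff) (auto simp: compact_closure)
      let ?mx = "\<lambda>m. MAX i\<in>{1..n}. sup_norm (closure \<Omega>) (\<lambda>x. \<phi> i x - \<phi>' i m x)"
      have mx: "sup_norm (closure \<Omega>) (\<lambda>x. \<phi> i x - \<phi>' i m x) \<le> ?mx m" if "i \<in> {1..n}" for i m
        using that by (intro Max_ge) auto
      have sup_bound: "\<bar>\<phi> i x - \<phi>' i m x\<bar> \<le> ?mx m" if "i \<in> {1..n}" "1 \<le> m" "x \<in> closure \<Omega>" for i m x
        using order_trans[OF norm_le_sup_norm[OF bdd[OF that(1,2)] that(3)] mx[OF that(1)]] by simp
      have E_le: "\<bar>?v x - ?w m \<epsilon> x\<bar> \<le> ?E m \<epsilon>" if "1 \<le> m" "0 \<le> \<epsilon>" "x \<in> closure \<Omega>" for m \<epsilon> x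
      proof -
        have "\<bar>(MIN i\<in>{1..n}. \<phi> i x) - (MIN i\<in>{1..n}. \<phi>' i m x)\<bar>
            \<le> ?mx m"
          using sup_bound that by (intro concave_aggregation_nonexpansive[OF concave_aggregation_Min[OF n]]) auto
        moreover have "\<bar>?w m \<epsilon> x - (MIN i\<in>{1..n}. \<phi>' i m x)\<bar> \<le> (real n - 1) * \<epsilon>"
          unfolding v_approx_def by (rule smooth_min_error[OF g n that(2)])
        ultimately show ?thesis unfolding err_def v_min_def by linarith
      qed
      have E0: "0 \<le> ?E m \<epsilon>" if "1 \<le> m" "0 \<le> \<epsilon>" for m \<epsilon>
      proof -
        have "1 \<in> {1..n}" using n by simp
        then have "0 \<le> ?mx m" using sup_norm_nonneg[OF bdd] mx that(1) by (meson order_trans)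
        then show ?thesis unfolding err_def using n that(2) by simp
      qed
      have diff: "AE x in lebesgue_on \<Omega>. f differentiable at x"
        if "l-lipschitz_on \<Omega> f" "concave_on \<Omega> (\<lambda>x. f x - c / 2 * (norm x)\<^sup>2)" "0 \<le> c" for f :: "'a \<Rightarrow> real" and l c
        using semiconcave_lipschitz_gderiv_AE[OF assms(1,2) that(3,1,2)]
        by (intro AE_lebesgue_on_of_lborel[OF \<Omega>leb]) (auto elim: eventually_mono intro: GDERIV_imp_differentiable)
      \<comment> \<open>Integrability is claimed for every \<open>m\<close> and needs only some
        finite bounds, so \<open>L\<close> and \<open>C\<close> are enlarged to cover the
        derivatives at this \<open>m\<close>.\<close>
      have Lp_all: "in_Lp p \<Omega> (\<lambda>x. grad (?w m \<epsilon>) x - grad ?v x)" if "1 \<le> m" "0 \<le> \<epsilon>" "1 \<le> p" for m \<epsilon> p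
      proof (rule semiconcave_gradient_Lp_estimates(1)[OF assms(1) R _ E0[OF that(1,2)] _ _ _ _ _ order_refl that(3)])
        show "(max L (?gb m))-lipschitz_on \<Omega> ?v" "(max L (?gb m))-lipschitz_on \<Omega> (?w m \<epsilon>)"
          using that L by (auto intro!: v_lip w_lip)
        show "concave_on \<Omega> (\<lambda>x. ?v x - max C (?hb m) / 2 * (norm x)\<^sup>2)"
          "concave_on \<Omega> (\<lambda>x. ?w m \<epsilon> x - max C (?hb m) / 2 * (norm x)\<^sup>2)"
          using that by (intro v_sc w_sc; simp)+
        show "0 \<le> max C (?hb m)" using C by simp
        show "\<bar>?v x - ?w m \<epsilon> x\<bar> \<le> ?E m \<epsilon>" if "x \<in> \<Omega>" for x
          using E_le \<open>1 \<le> m\<close> \<open>0 \<le> \<epsilon>\<close> that closure_subset by blast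
      qed
      define J where "J m \<epsilon> = K\<^sub>0 * ?E m \<epsilon> * (C + L + ?E m \<epsilon>)" for m \<epsilon>
      have J_le: "real DIM('a) * (?E m \<epsilon> * (8 * (2 * L) + 4 * (2 * C))) * B \<le> J m \<epsilon>" if "1 \<le> m" "0 \<le> \<epsilon>" for m \<epsilon>
      proof -
        note e = E0[OF that]
        have "real DIM('a) * (?E m \<epsilon> * (8 * (2 * L) + 4 * (2 * C))) * B
            \<le> real DIM('a) * (?E m \<epsilon> * (16 * (C + L + ?E m \<epsilon>))) * B"
          using e C L B0 by (intro mult_right_mono mult_left_mono) auto
        also have "\<dots> = (16 * real DIM('a) * B) * (?E m \<epsilon> * (C + L + ?E m \<epsilon>))"
          by (simp add: algebra_simps)
        also have "\<dots> \<le> K\<^sub>0 * (?E m \<epsilon> * (C + L + ?E m \<epsilon>))"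
          unfolding K\<^sub>0_def using e C L by (intro mult_right_mono) auto
        finally show ?thesis unfolding J_def by (simp add: mult.assoc)
      qed
      \<comment> \<open>Positivity of \<open>L\<close> and \<open>C\<close> makes doubling a genuine
        slack above the limsup, so the doubled bounds hold from some index on.\<close>
      have "\<forall>\<^sub>F m in sequentially. ?gb m < 2 * L \<and> ?hb m < 2 * C"
        using gb_lim[of "2 * L"] hb_lim[of "2 * C"] L C by (intro eventually_conj) auto
      then obtain M where M: "\<And>m. M \<le> m \<Longrightarrow> ?gb m < 2 * L \<and> ?hb m < 2 * C"
        unfolding eventually_sequentially by blast
      have est: "2 \<le> p \<Longrightarrow> Lp_norm p \<Omega> (\<lambda>x. grad (?w m \<epsilon>) x - grad ?v x) \<le> ((2 * (2 * L)) powr (p - 2) * J m \<epsilon>) powr (1 / p)"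
        "1 \<le> p \<Longrightarrow> p < 2 \<Longrightarrow> Lp_norm p \<Omega> (\<lambda>x. grad (?w m \<epsilon>) x - grad ?v x)
          \<le> measure lebesgue \<Omega> powr ((2 - p) / (2 * p)) * J m \<epsilon> powr (1 / 2)"
        if m: "1 \<le> m" "0 \<le> \<epsilon>" "?gb m \<le> 2 * L" "?hb m \<le> 2 * C" for m \<epsilon> p
      proof -
        have E: "\<bar>?v x - ?w m \<epsilon> x\<bar> \<le> ?E m \<epsilon>" if "x \<in> \<Omega>" for x
          using E_le[OF m(1,2)] that closure_subset by blast
        have C2pos: "0 \<le> 2 * C" using C by simp
        have lips: "(2 * L)-lipschitz_on \<Omega> ?v" "(2 * L)-lipschitz_on \<Omega> (?w m \<epsilon>)"
          using m L by (auto intro!: v_lip w_lip)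
        have scs: "concave_on \<Omega> (\<lambda>x. ?v x - (2 * C) / 2 * (norm x)\<^sup>2)"
          "concave_on \<Omega> (\<lambda>x. ?w m \<epsilon> x - (2 * C) / 2 * (norm x)\<^sup>2)"
          using m C by (intro v_sc w_sc; simp)+
        note estimates = semiconcave_gradient_Lp_estimates[OF assms(1) R C2pos E0[OF m(1,2)]
            lips(1) scs(1) lips(2) scs(2) E J_le[OF m(1,2), unfolded B_def]]
        show "2 \<le> p \<Longrightarrow> Lp_norm p \<Omega> (\<lambda>x. grad (?w m \<epsilon>) x - grad ?v x) \<le> ((2 * (2 * L)) powr (p - 2) * J m \<epsilon>) powr (1 / p)"
          by (rule estimates(2))
        show "1 \<le> p \<Longrightarrow> p < 2 \<Longrightarrow> Lp_norm p \<Omega> (\<lambda>x. grad (?w m \<epsilon>) x - grad ?v x)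
          \<le> measure lebesgue \<Omega> powr ((2 - p) / (2 * p)) * J m \<epsilon> powr (1 / 2)"
          by (rule estimates(3))
      qed
      have J_eq: "((2 * (2 * L)) powr (p - 2) * J m \<epsilon>) powr (1 / p)
          = L powr ((p - 2) / p) * (K p * ?E m \<epsilon> * (C + L + ?E m \<epsilon>)) powr (1 / p)"
        if "1 \<le> m" "0 \<le> \<epsilon>" "2 \<le> p" for m \<epsilon> p
      proof -
        have "(2 * (2 * L)) powr (p - 2) = L powr (p - 2) * 4 powr (p - 2)"
          using powr_mult[of L 4 "p - 2"] L by (simp add: mult.commute)
        then have "(2 * (2 * L)) powr (p - 2) * J m \<epsilon> = L powr (p - 2) * (K p * ?E m \<epsilon> * (C + L + ?E m \<epsilon>))"
          unfolding J_def K_def using that(3) by (simp add: max_def)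
        then have "((2 * (2 * L)) powr (p - 2) * J m \<epsilon>) powr (1 / p)
            = (L powr (p - 2)) powr (1 / p) * (K p * ?E m \<epsilon> * (C + L + ?E m \<epsilon>)) powr (1 / p)"
          by (simp only: powr_mult)
        then show ?thesis by (simp add: powr_powr)
      qed
      show ?case
      proof (intro conjI)
        show "\<forall>m\<ge>1. \<forall>\<epsilon>\<ge>0. sup_norm (closure \<Omega>) (\<lambda>x. ?v x - ?w m \<epsilon> x) \<le> ?E m \<epsilon>"
          using E_le E0 by (auto intro!: sup_norm_leI)
        show "AE x in lebesgue_on \<Omega>. ?v differentiable at x"
          using C by (intro diff[OF v_lip v_sc]) auto
        show "\<forall>m\<ge>1. \<forall>\<epsilon>\<ge>0. AE x in lebesgue_on \<Omega>. ?w m \<epsilon> differentiable at x"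
        proof (intro allI impI)
          fix m :: nat and \<epsilon> :: real assume m: "1 \<le> m" "0 \<le> \<epsilon>"
          show "AE x in lebesgue_on \<Omega>. ?w m \<epsilon> differentiable at x"
            using m by (intro diff[OF w_lip[where l = "max 0 (?gb m)"] w_sc[where c = "max 0 (?hb m)"]]) auto
        qed
        show "\<forall>m\<ge>1. \<forall>\<epsilon>\<ge>0. \<forall>p\<ge>1. in_Lp p \<Omega> (\<lambda>x. grad (?w m \<epsilon>) x - grad ?v x)"
          using Lp_all by blast
        show "semiconcave C \<Omega> ?v"
          unfolding semiconcave_def using v_cont v_sc[of C] by simp
        show "L-lipschitz_on (closure \<Omega>) ?v"
          using v_lip[of L] v_cont by (intro lipschitz_on_closure) auto
      next
        show "\<exists>M. \<forall>m\<ge>1. m \<ge> M \<or> (?gb m \<le> L \<and> ?hb m \<le> C) \<longrightarrow>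
            (\<forall>\<epsilon>\<ge>0. \<forall>p.
              (2 \<le> p \<longrightarrow>
                 Lp_norm p \<Omega> (\<lambda>x. grad (?w m \<epsilon>) x - grad ?v x)
                 \<le> L powr ((p - 2) / p) * (K p * ?E m \<epsilon> * (C + L + ?E m \<epsilon>)) powr (1 / p)) \<and>
              (1 \<le> p \<and> p < 2 \<longrightarrow>
                 Lp_norm p \<Omega> (\<lambda>x. grad (?w m \<epsilon>) x - grad ?v x)
                 \<le> measure lebesgue \<Omega> powr ((2 - p) / (2 * p)) *
                   (K p * ?E m \<epsilon> * (C + L + ?E m \<epsilon>)) powr (1 / 2)))"
        proof (intro exI[of _ M] allI impI conjI)
          fix m :: nat and \<epsilon> p :: real
          assume "1 \<le> m" "M \<le> m \<or> (?gb m \<le> L \<and> ?hb m \<le> C)" "0 \<le> \<epsilon>"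
          then have m: "1 \<le> m" "0 \<le> \<epsilon>" "?gb m \<le> 2 * L" "?hb m \<le> 2 * C" using M[of m] L C by auto
          show "Lp_norm p \<Omega> (\<lambda>x. grad (?w m \<epsilon>) x - grad ?v x)
              \<le> L powr ((p - 2) / p) * (K p * ?E m \<epsilon> * (C + L + ?E m \<epsilon>)) powr (1 / p)" if "2 \<le> p"
            using est(1)[OF m that] unfolding J_eq[OF m(1,2) that] .
          show "Lp_norm p \<Omega> (\<lambda>x. grad (?w m \<epsilon>) x - grad ?v x)
              \<le> measure lebesgue \<Omega> powr ((2 - p) / (2 * p)) * (K p * ?E m \<epsilon> * (C + L + ?E m \<epsilon>)) powr (1 / 2)"
            if "1 \<le> p \<and> p < 2"
          proof -
            have "K p = K\<^sub>0" unfolding K_def using that by simp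
            then show ?thesis using est(2)[OF m, of p] that unfolding J_def by simp
          qed
        qed
      qed
    qed
  qed
qed

end
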